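(* Let $k\ge 2$ and let $(M^n,g;\mathcal D_1,\ldots,\mathcal D_k)$ be a Riemannian almost $k$-product manifold with $\dim\mathcal D_i=n_i$, $\sum_{i=1}^k n_i=n$, and let $f:(M^n,g;\mathcal D_1,\ldots,\mathcal D_k)\to(\bar M^m,\bar g)$, $n<m$, be an isometric immersion in a Riemannian manifold. Then, at every point of $M$, $$\mathrm{S}_{\rm mix}(\mathcal D_1,\ldots,\mathcal D_k)\le \frac{k-1}{2k}\,\|\bar H\|^2+\bar\delta_{\rm mix}(n_1,\ldots,n_k).$$ Equality holds (at all points of $M$) if and only if $f$ is mixed totally geodesic, $\bar H_1=\ldots=\bar H_k$, and $\bar{\mathrm S}_{\rm mix}(\mathcal D_1(x),\ldots,\mathcal D_k(x))=\bar\delta_{\rm mix}(n_1,\ldots,n_k)$ at each point $x\in M$.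
   Context: A Riemannian almost $k$-product manifold $(M,g;\mathcal D_1,\ldots,\mathcal D_k)$ is a Riemannian manifold with $k\ge2$ pairwise orthogonal distributions (subbundles of $TM$) such that $TM=\bigoplus_{i=1}^k\mathcal D_i$. Let $K$ and $\bar K$ denote the sectional curvatures of $(M,g)$ and $(\bar M,\bar g)$. Mixed scalar curvature of $M$: $\mathrm S_{\rm mix}(\mathcal D_1,\ldots,\mathcal D_k)=\sum_{i<j}\mathrm S_{\rm mix}(\mathcal D_i,\mathcal D_j)$, where at $x\in M$, $\mathrm S_{\rm mix}(\mathcal D_i(x),\mathcal D_j(x))=\sum_{a,b}K(e_a,e'_b)$ for orthonormal bases $\{e_a\}$ of $\mathcal D_i(x)$ and $\{e'_b\}$ of $\mathcal D_j(x)$; this does not depend on the bases. For pairwise orthogonal subspaces $V_1,\ldots,V_k$ of $T_x\bar M$ set $\bar{\mathrm S}_{\rm mix}(V_1,\ldots,V_k)=\sum_{i<j}\sum_{a,b}\bar K(e^{(i)}_a,e^{(j)}_b)$, where $\{e^{(i)}_a\}$ is any orthonormal basis of $V_i$. Define $\bar\delta_{\rm mix}(n_1,\ldots,n_k)=\sup\bar{\mathrm S}_{\rm mix}(V_1,\ldots,V_k)$ over all $x\in\bar M$ and all pairwise orthogonal subspaces $V_i\subset T_x\bar M$ with $\dim V_i=n_i$. $M$ is identified with its image $f(M)$. Let $\bar h:TM\times TM\to TM^\perp$ be the second fundamental form of $f$, $\bar h_i$ its restriction to $\mathcal D_i\times\mathcal D_i$, $\bar H=\operatorname{trace}\bar h$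 (not divided by the dimension) the mean curvature vector, and $\bar H_i=\operatorname{trace}\bar h_i$, so that $\bar H=\sum_i\bar H_i$. The immersion $f$ is mixed totally geodesic if $\bar h(X,Y)=0$ for all $X\in\mathcal D_i$, $Y\in\mathcal D_j$, $i\ne j$. *)

theory Defs
  imports "HOL-Analysis.Analysis"
begin

section \<open>Smooth maps between Euclidean spaces\<close>

fun Ck_on :: "nat \<Rightarrow> 'e::euclidean_space set \<Rightarrow> ('e \<Rightarrow> 'f::euclidean_space) \<Rightarrow> bool" where
  "Ck_on 0 S F \<longleftrightarrow> continuous_on S F"
| "Ck_on (Suc r) S F \<longleftrightarrow>
     (\<forall>x\<in>S. F differentiable (at x)) \<and>
     (\<forall>v. Ck_on r S (\<lambda>x. frechet_derivative F (at x) v))"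

text \<open>Only used for open \<open>S\<close>, where this means \<open>C\<^sup>\<infinity>\<close> in the usual sense: all iterated directional
  derivatives exist and are continuous.\<close>

definition smooth_on :: "'e::euclidean_space set \<Rightarrow> ('e \<Rightarrow> 'f::euclidean_space) \<Rightarrow> bool" where
  "smooth_on S F \<longleftrightarrow> (\<forall>r. Ck_on r S F)"


section \<open>Smooth manifolds\<close>

text \<open>A manifold is a topology together with a smooth atlas (not required to be maximal). A chart is
  a pair of its domain and its coordinate map; the dimension of the manifold is the dimension
  of the model space \<^typ>\<open>'e\<close>.\<close>

type_synonym ('a, 'e) chart = "'a set \<times> ('a \<Rightarrow> 'e)"

definition chart_inv :: "('a, 'e) chart \<Rightarrow> 'e \<Rightarrow> 'a" where
  "chart_inv c = inv_into (fst c) (snd c)"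

definition loc_rep :: "('a, 'e) chart \<Rightarrow> ('b, 'f) chart \<Rightarrow> ('a \<Rightarrow> 'b) \<Rightarrow> 'e \<Rightarrow> 'f" where
  "loc_rep c d f = snd d \<circ> f \<circ> chart_inv c"

definition smooth_manifold :: "'a topology \<Rightarrow> ('a, 'e::euclidean_space) chart set \<Rightarrow> bool" where
  "smooth_manifold X A \<longleftrightarrow>
     Hausdorff_space X \<and> second_countable X \<and>
     (\<forall>c\<in>A. openin X (fst c) \<and> open (snd c ` fst c) \<and>
        homeomorphic_map (subtopology X (fst c)) (top_of_set (snd c ` fst c)) (snd c)) \<and>
     (\<Union>c\<in>A. fst c) = topspace X \<and>
     (\<forall>c\<in>A. \<forall>d\<in>A. smooth_on (snd c ` (fst c \<inter> fst d)) (loc_rep c d id))"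

definition smooth_map ::
  "'a topology \<Rightarrow> ('a, 'e::euclidean_space) chart set \<Rightarrow>
   'b topology \<Rightarrow> ('b, 'f::euclidean_space) chart set \<Rightarrow> ('a \<Rightarrow> 'b) \<Rightarrow> bool" where
  "smooth_map X A Y B f \<longleftrightarrow>
     continuous_map X Y f \<and>
     (\<forall>c\<in>A. \<forall>d\<in>B. smooth_on (snd c ` {p \<in> fst c. f p \<in> fst d}) (loc_rep c d f))"


section \<open>Tangent vectors\<close>

text \<open>The tangent space at \<open>p\<close> is the vector space \<^typ>\<open>'e\<close>: a tangent vector is given by its
  components in one chart around \<open>p\<close>, chosen once and for all. Its components in any other chart
  are obtained from the derivative of the transition map. No inner product or norm of \<^typ>\<open>'e\<close>
  enters into the geometry; lengths and angles come from the metric tensor only.\<close>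

definition chart_at :: "('a, 'e) chart set \<Rightarrow> 'a \<Rightarrow> ('a, 'e) chart" where
  "chart_at A p = (SOME c. c \<in> A \<and> p \<in> fst c)"

definition to_chart ::
  "('a, 'e::euclidean_space) chart set \<Rightarrow> ('a, 'e) chart \<Rightarrow> 'a \<Rightarrow> 'e \<Rightarrow> 'e" where
  "to_chart A c p = frechet_derivative (loc_rep (chart_at A p) c id) (at (snd (chart_at A p) p))"

definition from_chart ::
  "('a, 'e::euclidean_space) chart set \<Rightarrow> ('a, 'e) chart \<Rightarrow> 'a \<Rightarrow> 'e \<Rightarrow> 'e" where
  "from_chart A c p = frechet_derivative (loc_rep c (chart_at A p) id) (at (snd c p))"

definition differential ::
  "('a, 'e::euclidean_space) chart set \<Rightarrow> ('b, 'f::euclidean_space) chart set \<Rightarrow>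
   ('a \<Rightarrow> 'b) \<Rightarrow> 'a \<Rightarrow> 'e \<Rightarrow> 'f" where
  "differential A B f p =
     frechet_derivative (loc_rep (chart_at A p) (chart_at B (f p)) f) (at (snd (chart_at A p) p))"

definition smooth_vector_field ::
  "('a, 'e::euclidean_space) chart set \<Rightarrow> 'a set \<Rightarrow> ('a \<Rightarrow> 'e) \<Rightarrow> bool" where
  "smooth_vector_field A W E \<longleftrightarrow>
     (\<forall>c\<in>A. smooth_on (snd c ` (fst c \<inter> W))
        (\<lambda>x. to_chart A c (chart_inv c x) (E (chart_inv c x))))"

text \<open>A subbundle of rank \<open>r\<close> of the tangent bundle: locally the span of a smooth frame.\<close>

definition distribution ::
  "'a topology \<Rightarrow> ('a, 'e::euclidean_space) chart set \<Rightarrow> nat \<Rightarrow> ('a \<Rightarrow> 'e set) \<Rightarrow> bool" where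
  "distribution X A r D \<longleftrightarrow>
     (\<forall>p\<in>topspace X. subspace (D p) \<and> dim (D p) = r) \<and>
     (\<forall>p\<in>topspace X. \<exists>W E. openin X W \<and> p \<in> W \<and>
        (\<forall>j<r. smooth_vector_field A W (E j)) \<and>
        (\<forall>q\<in>W. D q = span ((\<lambda>j. E j q) ` {..<r})))"


section \<open>Riemannian metrics and curvature\<close>

definition metric_in_chart ::
  "('a, 'e::euclidean_space) chart set \<Rightarrow> ('a \<Rightarrow> 'e \<Rightarrow> 'e \<Rightarrow> real) \<Rightarrow>
   ('a, 'e) chart \<Rightarrow> 'e \<Rightarrow> 'e \<Rightarrow> 'e \<Rightarrow> real" where
  "metric_in_chart A g c x u v =
     g (chart_inv c x) (from_chart A c (chart_inv c x) u) (from_chart A c (chart_inv c x) v)"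

definition inner_product :: "('e::real_vector \<Rightarrow> 'e \<Rightarrow> real) \<Rightarrow> bool" where
  "inner_product b \<longleftrightarrow>
     (\<forall>v. linear (\<lambda>u. b u v)) \<and> (\<forall>u v. b u v = b v u) \<and> (\<forall>u. u \<noteq> 0 \<longrightarrow> b u u > 0)"

definition riemannian_manifold ::
  "'a topology \<Rightarrow> ('a, 'e::euclidean_space) chart set \<Rightarrow> ('a \<Rightarrow> 'e \<Rightarrow> 'e \<Rightarrow> real) \<Rightarrow> bool" where
  "riemannian_manifold X A g \<longleftrightarrow>
     smooth_manifold X A \<and> (\<forall>p\<in>topspace X. inner_product (g p)) \<and>
     (\<forall>c\<in>A. \<forall>u v. smooth_on (snd c ` fst c) (\<lambda>x. metric_in_chart A g c x u v))"

text \<open>The next four definitions concern a metric \<open>G\<close> on an open subset of \<^typ>\<open>'e\<close>.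
  \<open>christoffel G x u v\<close> is the vector \<open>\<Gamma>(u,v) = \<nabla>\<^sub>u v\<close> for constant fields \<open>u\<close>, \<open>v\<close>, determined by
  the Koszul formula; the brackets of constant fields vanish.\<close>

definition christoffel ::
  "('e::euclidean_space \<Rightarrow> 'e \<Rightarrow> 'e \<Rightarrow> real) \<Rightarrow> 'e \<Rightarrow> 'e \<Rightarrow> 'e \<Rightarrow> 'e" where
  "christoffel G x u v = (THE w. \<forall>z. 2 * G x w z =
       frechet_derivative (\<lambda>y. G y v z) (at x) u
     + frechet_derivative (\<lambda>y. G y u z) (at x) v
     - frechet_derivative (\<lambda>y. G y u v) (at x) z)"

definition cov_deriv ::
  "('e::euclidean_space \<Rightarrow> 'e \<Rightarrow> 'e \<Rightarrow> real) \<Rightarrow> 'e \<Rightarrow> ('e \<Rightarrow> 'e) \<Rightarrow> 'e \<Rightarrow> 'e" where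
  "cov_deriv G u V x = frechet_derivative V (at x) u + christoffel G x u (V x)"

text \<open>Covariant derivative of a vector field \<open>V\<close> along a map \<open>F\<close>.\<close>

definition cov_deriv_along ::
  "('f::euclidean_space \<Rightarrow> 'f \<Rightarrow> 'f \<Rightarrow> real) \<Rightarrow> ('e::euclidean_space \<Rightarrow> 'f) \<Rightarrow>
   'e \<Rightarrow> ('e \<Rightarrow> 'f) \<Rightarrow> 'e \<Rightarrow> 'f" where
  "cov_deriv_along G F u V x =
     frechet_derivative V (at x) u + christoffel G (F x) (frechet_derivative F (at x) u) (V x)"

text \<open>\<open>R(u,v)w = \<nabla>\<^sub>u\<nabla>\<^sub>v w - \<nabla>\<^sub>v\<nabla>\<^sub>u w\<close>; the term \<open>\<nabla>\<^bsub>[u,v]\<^esub> w\<close> vanishes for constant fields.\<close>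

definition curvature ::
  "('e::euclidean_space \<Rightarrow> 'e \<Rightarrow> 'e \<Rightarrow> real) \<Rightarrow> 'e \<Rightarrow> 'e \<Rightarrow> 'e \<Rightarrow> 'e \<Rightarrow> 'e" where
  "curvature G x u v w =
     cov_deriv G u (cov_deriv G v (\<lambda>_. w)) x - cov_deriv G v (cov_deriv G u (\<lambda>_. w)) x"

definition sectional_curvature ::
  "('a, 'e::euclidean_space) chart set \<Rightarrow> ('a \<Rightarrow> 'e \<Rightarrow> 'e \<Rightarrow> real) \<Rightarrow> 'a \<Rightarrow> 'e \<Rightarrow> 'e \<Rightarrow> real" where
  "sectional_curvature A g p u v =
     g p (curvature (metric_in_chart A g (chart_at A p)) (snd (chart_at A p) p) u v v) u
       / (g p u u * g p v v - (g p u v)\<^sup>2)"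


section \<open>Mixed scalar curvature\<close>

definition orthonormal_basis_of ::
  "('e::euclidean_space \<Rightarrow> 'e \<Rightarrow> real) \<Rightarrow> 'e set \<Rightarrow> 'e set \<Rightarrow> bool" where
  "orthonormal_basis_of b V E \<longleftrightarrow>
     E \<subseteq> V \<and> span E = V \<and> (\<forall>e\<in>E. \<forall>e'\<in>E. b e e' = (if e = e' then 1 else 0))"

text \<open>All traces and curvature sums below are independent of the orthonormal basis, so an arbitrary
  one is selected.\<close>

definition some_onb :: "('e::euclidean_space \<Rightarrow> 'e \<Rightarrow> real) \<Rightarrow> 'e set \<Rightarrow> 'e set" where
  "some_onb b V = (SOME E. orthonormal_basis_of b V E)"

definition orthogonal_family ::
  "('e::euclidean_space \<Rightarrow> 'e \<Rightarrow> real) \<Rightarrow> nat \<Rightarrow> (nat \<Rightarrow> 'e set) \<Rightarrow> bool" where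
  "orthogonal_family b k V \<longleftrightarrow>
     (\<forall>i\<in>{1..k}. \<forall>j\<in>{1..k}. i \<noteq> j \<longrightarrow> (\<forall>u\<in>V i. \<forall>v\<in>V j. b u v = 0))"

definition mixed_scalar_curvature ::
  "('a, 'e::euclidean_space) chart set \<Rightarrow> ('a \<Rightarrow> 'e \<Rightarrow> 'e \<Rightarrow> real) \<Rightarrow> nat \<Rightarrow> 'a \<Rightarrow>
   (nat \<Rightarrow> 'e set) \<Rightarrow> real" where
  "mixed_scalar_curvature A g k p V =
     (\<Sum>i=1..k. \<Sum>j=Suc i..k. \<Sum>e\<in>some_onb (g p) (V i). \<Sum>e'\<in>some_onb (g p) (V j).
        sectional_curvature A g p e e')"

text \<open>The supremum is taken in the extended reals, as it may be infinite on a noncompact manifold.\<close>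

definition delta_mix ::
  "'b topology \<Rightarrow> ('b, 'f::euclidean_space) chart set \<Rightarrow> ('b \<Rightarrow> 'f \<Rightarrow> 'f \<Rightarrow> real) \<Rightarrow> nat \<Rightarrow>
   (nat \<Rightarrow> nat) \<Rightarrow> ereal" where
  "delta_mix Y B gb k n =
     Sup {ereal (mixed_scalar_curvature B gb k y V) | y V.
            y \<in> topspace Y \<and> (\<forall>i\<in>{1..k}. subspace (V i) \<and> dim (V i) = n i) \<and>
            orthogonal_family (gb y) k V}"


section \<open>Almost product structures and isometric immersions\<close>

definition almost_product_manifold ::
  "'a topology \<Rightarrow> ('a, 'e::euclidean_space) chart set \<Rightarrow> ('a \<Rightarrow> 'e \<Rightarrow> 'e \<Rightarrow> real) \<Rightarrow> nat \<Rightarrow>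
   (nat \<Rightarrow> 'a \<Rightarrow> 'e set) \<Rightarrow> (nat \<Rightarrow> nat) \<Rightarrow> bool" where
  "almost_product_manifold X A g k D n \<longleftrightarrow>
     riemannian_manifold X A g \<and> k \<ge> 2 \<and>
     (\<forall>i\<in>{1..k}. distribution X A (n i) (D i)) \<and>
     (\<forall>p\<in>topspace X. orthogonal_family (g p) k (\<lambda>i. D i p)) \<and>
     (\<forall>p\<in>topspace X. \<forall>v. \<exists>!w. w \<in> (\<Pi>\<^sub>E i\<in>{1..k}. D i p) \<and> v = (\<Sum>i=1..k. w i))"

definition isometric_immersion ::
  "'a topology \<Rightarrow> ('a, 'e::euclidean_space) chart set \<Rightarrow> ('a \<Rightarrow> 'e \<Rightarrow> 'e \<Rightarrow> real) \<Rightarrow>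
   'b topology \<Rightarrow> ('b, 'f::euclidean_space) chart set \<Rightarrow> ('b \<Rightarrow> 'f \<Rightarrow> 'f \<Rightarrow> real) \<Rightarrow>
   ('a \<Rightarrow> 'b) \<Rightarrow> bool" where
  "isometric_immersion X A g Y B gb f \<longleftrightarrow>
     smooth_map X A Y B f \<and>
     (\<forall>p\<in>topspace X. inj (differential A B f p) \<and>
        (\<forall>u v. g p u v = gb (f p) (differential A B f p u) (differential A B f p v)))"

definition normal_part :: "('f::euclidean_space \<Rightarrow> 'f \<Rightarrow> real) \<Rightarrow> 'f set \<Rightarrow> 'f \<Rightarrow> 'f" where
  "normal_part b T z = (THE w. z - w \<in> T \<and> (\<forall>t\<in>T. b w t = 0))"

text \<open>\<open>h(u,v)\<close> is the normal part of the ambient covariant derivative, in direction \<open>u\<close>, of the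
  push-forward of a local field extending \<open>v\<close>. The extension used here has constant components
  in the chart around \<open>p\<close>; \<open>h\<close> is tensorial, so any other extension gives the same value.\<close>

definition second_fundamental_form ::
  "('a, 'e::euclidean_space) chart set \<Rightarrow>
   ('b, 'f::euclidean_space) chart set \<Rightarrow> ('b \<Rightarrow> 'f \<Rightarrow> 'f \<Rightarrow> real) \<Rightarrow>
   ('a \<Rightarrow> 'b) \<Rightarrow> 'a \<Rightarrow> 'e \<Rightarrow> 'e \<Rightarrow> 'f" where
  "second_fundamental_form A B gb f p u v =
     (let c = chart_at A p; d = chart_at B (f p); F = loc_rep c d f in
      normal_part (gb (f p)) (range (differential A B f p))
        (cov_deriv_along (metric_in_chart B gb d) F u (\<lambda>x. frechet_derivative F (at x) v)
           (snd c p)))"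

text \<open>The trace of the second fundamental form restricted to a subspace \<open>V\<close> of the tangent space
  at \<open>p\<close>, not divided by the dimension. For \<open>V = UNIV\<close> this is the mean curvature vector.\<close>

definition mean_curvature_on ::
  "('a, 'e::euclidean_space) chart set \<Rightarrow> ('a \<Rightarrow> 'e \<Rightarrow> 'e \<Rightarrow> real) \<Rightarrow>
   ('b, 'f::euclidean_space) chart set \<Rightarrow> ('b \<Rightarrow> 'f \<Rightarrow> 'f \<Rightarrow> real) \<Rightarrow>
   ('a \<Rightarrow> 'b) \<Rightarrow> 'a \<Rightarrow> 'e set \<Rightarrow> 'f" where
  "mean_curvature_on A g B gb f p V =
     (\<Sum>e\<in>some_onb (g p) V. second_fundamental_form A B gb f p e e)"

definition mean_curvature ::
  "('a, 'e::euclidean_space) chart set \<Rightarrow> ('a \<Rightarrow> 'e \<Rightarrow> 'e \<Rightarrow> real) \<Rightarrow>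
   ('b, 'f::euclidean_space) chart set \<Rightarrow> ('b \<Rightarrow> 'f \<Rightarrow> 'f \<Rightarrow> real) \<Rightarrow>
   ('a \<Rightarrow> 'b) \<Rightarrow> 'a \<Rightarrow> 'f" where
  "mean_curvature A g B gb f p = mean_curvature_on A g B gb f p UNIV"

definition mixed_totally_geodesic ::
  "'a topology \<Rightarrow> ('a, 'e::euclidean_space) chart set \<Rightarrow>
   ('b, 'f::euclidean_space) chart set \<Rightarrow> ('b \<Rightarrow> 'f \<Rightarrow> 'f \<Rightarrow> real) \<Rightarrow>
   ('a \<Rightarrow> 'b) \<Rightarrow> nat \<Rightarrow> (nat \<Rightarrow> 'a \<Rightarrow> 'e set) \<Rightarrow> bool" where
  "mixed_totally_geodesic X A B gb f k D \<longleftrightarrow>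
     (\<forall>p\<in>topspace X. \<forall>i\<in>{1..k}. \<forall>j\<in>{1..k}. i \<noteq> j \<longrightarrow>
        (\<forall>u\<in>D i p. \<forall>v\<in>D j p. second_fundamental_form A B gb f p u v = 0))"

end

theory Submission
  imports Defs
begin

text \<open>By the Gauss equation, for orthonormal \<open>e\<close>, \<open>e'\<close> the sectional curvatures of \<open>M\<close> and of the
  ambient manifold differ by \<open>\<langle>h(e,e), h(e',e')\<rangle> - \<parallel>h(e,e')\<parallel>\<^sup>2\<close>. Summing over orthonormal bases of the
  distributions gives
  \<open>S = Sb + (\<Sum>i<j. \<langle>H\<^sub>i, H\<^sub>j\<rangle>) - (\<Sum>i<j. \<Sum>e e'. \<parallel>h(e,e')\<parallel>\<^sup>2)\<close>, and, since \<open>H = (\<Sum>i. H\<^sub>i)\<close>,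
  \<open>(\<Sum>i<j. \<langle>H\<^sub>i, H\<^sub>j\<rangle>) = (k - 1)/(2k) \<parallel>H\<parallel>\<^sup>2 - 1/(2k) (\<Sum>i<j. \<parallel>H\<^sub>i - H\<^sub>j\<parallel>\<^sup>2)\<close>.
  The two nonpositive terms and \<open>Sb - \<delta>\<close> are the three contributions to the equality case.

  In charts, the Gauss equation follows by differentiating \<open>\<langle>\<nabla>\<^sub>v F\<^sub>w, F\<^sub>z\<rangle> = G(\<Gamma>(v,w), z)\<close>, which is the
  Koszul formula for the pulled back metric, where \<open>F\<^sub>z\<close> is the push-forward of the constant field \<open>z\<close>.\<close>

section \<open>Inner products and orthonormal bases\<close>

text \<open>The proof in charts is shaped by what the definitions provide. \<open>smooth_on\<close>
  speaks only of iterated directional derivatives, so the symmetry of the second and third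
  derivatives of \<open>F\<close> has to be derived. \<open>christoffel\<close> is a definite
  description, so its existence and its differentiability have to be read off from the linear system
  that it solves. The identity that is differentiated is scalar and holds on an open set; thus no
  derivative of the normal projection ever occurs. The isometry condition is stated at each point in
  the charts selected for that point and for its image, and must first be transported to one fixed
  pair of charts. Traces are taken over selected bases, and the push-forward of a selected basis
  need not be the one selected for the image space. Bases must therefore be exchangeable, which is a
  matter of bilinearity; hence the passage from sectional curvatures to the curvature
  tensor.\<close>

lemma inner_product_bilinear:
  assumes "inner_product b"
  shows "bilinear b"
proof -
  have 1: "linear (\<lambda>v. b v u)" for u
    using assms unfolding inner_product_def by blast
  have "(\<lambda>v. b v u) = b u" for u
    using assms unfolding inner_product_def by blast
  from subst[of _ _ linear, OF this 1] have "linear (\<lambda>v. b u v)" for u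
    by simp
  with 1 show ?thesis
    unfolding bilinear_def by blast
qed

lemma inner_product_commute: "inner_product b \<Longrightarrow> b u v = b v u"
  unfolding inner_product_def by blast

lemma inner_product_eq_0_iff:
  assumes "inner_product b"
  shows "b u u = 0 \<longleftrightarrow> u = 0"
  using assms bilinear_lzero[OF inner_product_bilinear[OF assms], of 0]
  unfolding inner_product_def by (metis less_irrefl)

lemma inner_product_ge_0: "inner_product b \<Longrightarrow> b u u \<ge> 0"
  using inner_product_eq_0_iff[of b u] unfolding inner_product_def
  by (metis less_imp_le order_refl)

lemma inner_product_eqI:
  assumes b: "inner_product b" and "\<And>z. b u z = b v z"
  shows "u = v"
proof -
  have "b (u - v) (u - v) = 0"
    using assms(2) by (simp add: bilinear_lsub[OF inner_product_bilinear[OF b]])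
  then show ?thesis
    using inner_product_eq_0_iff[OF b] by simp
qed

lemma bilinear_sum_left: "bilinear b \<Longrightarrow> b (sum f I) v = (\<Sum>i\<in>I. b (f i) v)"
  using linear_sum[of "\<lambda>u. b u v" f I] by (simp add: bilinear_def)

lemma bilinear_sum_right: "bilinear b \<Longrightarrow> b u (sum f I) = (\<Sum>i\<in>I. b u (f i))"
  using linear_sum[of "b u" f I] by (simp add: bilinear_def)

lemma orthonormal_basis_independent:
  assumes b: "inner_product b" and E: "orthonormal_basis_of b V E"
  shows "independent E"
proof -
  note bil = inner_product_bilinear[OF b]
  have "r e = 0" if "finite T" "T \<subseteq> E" "(\<Sum>v\<in>T. r v *\<^sub>R v) = 0" "e \<in> T" for T r e
  proof -
    have "0 = b (\<Sum>v\<in>T. r v *\<^sub>R v) e"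
      using that bilinear_lzero[OF bil] by simp
    also have "\<dots> = (\<Sum>v\<in>T. r v * b v e)"
      by (simp add: bilinear_sum_left[OF bil] bilinear_lmul[OF bil])
    also have "\<dots> = (\<Sum>v\<in>T. if v = e then r v else 0)"
      using E that by (intro sum.cong) (auto simp: orthonormal_basis_of_def subset_iff)
    also have "\<dots> = r e"
      using that by simp
    finally show ?thesis by simp
  qed
  then show ?thesis
    unfolding independent_explicit_module by blast
qed

text \<open>\<open>orthonormal_basis_of\<close> does not ask for finiteness, and a sum over an
  infinite set would be 0 by convention. Independence rules this out.\<close>

lemma orthonormal_basis_finite:
  fixes E :: "'e::euclidean_space set"
  assumes "inner_product b" "orthonormal_basis_of b V E"
  shows "finite E"
  using orthonormal_basis_independent[OF assms] by (simp add: independent_imp_finite)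

lemma orthonormal_basis_expansion:
  fixes E :: "'e::euclidean_space set"
  assumes b: "inner_product b" and E: "orthonormal_basis_of b V E" and v: "v \<in> V"
  shows "v = (\<Sum>e\<in>E. b v e *\<^sub>R e)"
proof -
  note bil = inner_product_bilinear[OF b]
  have fin: "finite E" by (rule orthonormal_basis_finite[OF b E])
  have "v \<in> span E" using E v by (simp add: orthonormal_basis_of_def)
  then obtain r where r: "v = (\<Sum>e\<in>E. r e *\<^sub>R e)"
    using fin by (auto simp: span_finite)
  have "b v e = r e" if "e \<in> E" for e
  proof -
    have "b v e = (\<Sum>e'\<in>E. r e' * b e' e)"
      by (simp add: r bilinear_sum_left[OF bil] bilinear_lmul[OF bil])
    also have "\<dots> = (\<Sum>e'\<in>E. if e' = e then r e' else 0)"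
      using E that by (intro sum.cong) (auto simp: orthonormal_basis_of_def)
    finally show ?thesis using fin that by simp
  qed
  then show ?thesis using r by simp
qed

text \<open>Gram-Schmidt, one vector of \<open>C\<close> per induction step.\<close>

lemma ex_orthonormal_basis_span:
  fixes b :: "'e::euclidean_space \<Rightarrow> 'e \<Rightarrow> real"
  assumes b: "inner_product b" and "finite C"
  shows "\<exists>E. orthonormal_basis_of b (span C) E"
  using \<open>finite C\<close>
proof (induction C)
  case empty
  then show ?case
    by (intro exI[of _ "{}"]) (simp add: orthonormal_basis_of_def)
next
  case (insert a C)
  note bil = inner_product_bilinear[OF b]
  obtain E where E: "orthonormal_basis_of b (span C) E"
    using insert.IH by blast
  have fin: "finite E" by (rule orthonormal_basis_finite[OF b E])
  have spE: "span E = span C" using E by (simp add: orthonormal_basis_of_def)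
  define p where "p = (\<Sum>e\<in>E. b a e *\<^sub>R e)"
  define w where "w = a - p"
  have p: "p \<in> span E"
    unfolding p_def by (intro span_sum span_scale span_base)
  have orth: "b w e = 0" if "e \<in> E" for e
  proof -
    have "b p e = (\<Sum>e'\<in>E. b a e' * b e' e)"
      by (simp add: p_def bilinear_sum_left[OF bil] bilinear_lmul[OF bil])
    also have "\<dots> = (\<Sum>e'\<in>E. if e' = e then b a e' else 0)"
      using E that by (intro sum.cong) (auto simp: orthonormal_basis_of_def)
    finally show ?thesis
      using fin that by (simp add: w_def bilinear_lsub[OF bil])
  qed
  have spa: "span (insert a C) = span (insert w E)"
  proof -
    have "span (insert a C) = span (insert a E)"
      by (metis span_insert spE)
    also have "\<dots> = span (insert w E)"
      using p by (intro eq_span_insert_eq) (simp add: w_def)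
    finally show ?thesis .
  qed
  show ?case
  \<comment> \<open>\<open>C\<close> is not assumed independent: if \<open>w = 0\<close>, then
    \<open>a\<close> adds nothing to the span and the old basis is kept.\<close>
  proof (cases "w = 0")
    case True
    then have "span (insert a C) = span C"
      using spa spE by simp
    then show ?thesis using E by metis
  next
    case False
    define n where "n = w /\<^sub>R sqrt (b w w)"
    have pos: "b w w > 0" using False b unfolding inner_product_def by blast
    have nn: "b n n = 1"
      using pos by (simp add: n_def bilinear_lmul[OF bil] bilinear_rmul[OF bil] field_simps)
    have ne: "b n e = 0" "b e n = 0" if "e \<in> E" for e
      using orth[OF that] inner_product_commute[OF b, of e n]
      by (auto simp: n_def bilinear_lmul[OF bil])
    have "span (insert w E) = span (insert n E)"
    proof -
      have "w = sqrt (b w w) *\<^sub>R n" using pos by (simp add: n_def)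
      then have 1: "w \<in> span (insert n E)"
        by (metis insertI1 span_base span_scale)
      have 2: "n \<in> span (insert w E)"
        unfolding n_def by (intro span_scale span_base) simp
      have "insert w E \<subseteq> span (insert n E)" "insert n E \<subseteq> span (insert w E)"
        using 1 2 by (auto intro: span_base)
      then show ?thesis
        by (intro subset_antisym span_minimal) simp_all
    qed
    then have sp: "span (insert n E) = span (insert a C)"
      using spa by simp
    moreover have "insert n E \<subseteq> span (insert a C)"
      unfolding sp[symmetric] by (rule span_superset)
    moreover have "\<forall>e\<in>insert n E. \<forall>e'\<in>insert n E. b e e' = (if e = e' then 1 else 0)"
    proof (intro ballI)
      fix e e' assume "e \<in> insert n E" "e' \<in> insert n E"
      moreover have "n \<notin> E" using nn ne by force
      ultimately show "b e e' = (if e = e' then 1 else 0)"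
        using nn ne E unfolding orthonormal_basis_of_def by (metis insertE)
    qed
    ultimately have "orthonormal_basis_of b (span (insert a C)) (insert n E)"
      unfolding orthonormal_basis_of_def by blast
    then show ?thesis by blast
  qed
qed

lemma some_onb:
  fixes b :: "'e::euclidean_space \<Rightarrow> 'e \<Rightarrow> real"
  assumes "inner_product b" "subspace V"
  shows "orthonormal_basis_of b V (some_onb b V)"
proof -
  obtain C where C: "C \<subseteq> V" "independent C" "V \<subseteq> span C"
    by (metis basis_exists)
  have "span C = V"
    using C \<open>subspace V\<close> by (intro subset_antisym span_minimal)
  moreover have "finite C"
    using C(2) by (rule independent_imp_finite)
  ultimately have "\<exists>E. orthonormal_basis_of b V E"
    using ex_orthonormal_basis_span[OF assms(1)] by blast
  then show ?thesis
    unfolding some_onb_def by (rule someI_ex)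
qed

text \<open>Expanding the first argument in \<open>E'\<close> and then collapsing the sum over
  \<open>E\<close> in the second argument moves the trace from one basis to the other. The values
  lie in an arbitrary vector space, so that this covers both curvature sums and mean curvature
  vectors.\<close>

lemma orthonormal_basis_trace_unique:
  fixes V :: "'e::euclidean_space set" and \<beta> :: "'e \<Rightarrow> 'e \<Rightarrow> 'g::real_vector"
  assumes b: "inner_product b" and \<beta>: "bilinear \<beta>"
    and E: "orthonormal_basis_of b V E" and E': "orthonormal_basis_of b V E'"
  shows "(\<Sum>e\<in>E. \<beta> e e) = (\<Sum>e\<in>E'. \<beta> e e)"
proof -
  have sub: "E \<subseteq> V" "E' \<subseteq> V"
    using E E' by (auto simp: orthonormal_basis_of_def)
  have "(\<Sum>e\<in>E. \<beta> e e) = (\<Sum>e\<in>E. \<beta> (\<Sum>e'\<in>E'. b e e' *\<^sub>R e') e)"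
    using sub by (intro sum.cong refl arg_cong2[of _ _ _ _ \<beta>] orthonormal_basis_expansion[OF b E']) auto
  also have "\<dots> = (\<Sum>e\<in>E. \<Sum>e'\<in>E'. b e e' *\<^sub>R \<beta> e' e)"
    by (simp add: bilinear_sum_left[OF \<beta>] bilinear_lmul[OF \<beta>])
  also have "\<dots> = (\<Sum>e'\<in>E'. \<Sum>e\<in>E. b e' e *\<^sub>R \<beta> e' e)"
    by (subst sum.swap) (simp add: inner_product_commute[OF b])
  also have "\<dots> = (\<Sum>e'\<in>E'. \<beta> e' (\<Sum>e\<in>E. b e' e *\<^sub>R e))"
    by (simp add: bilinear_sum_right[OF \<beta>] bilinear_rmul[OF \<beta>])
  also have "\<dots> = (\<Sum>e'\<in>E'. \<beta> e' e')"
    using sub by (intro sum.cong refl arg_cong2[of _ _ _ _ \<beta>] orthonormal_basis_expansion[OF b E, symmetric]) auto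
  finally show ?thesis .
qed

text \<open>Riesz representation; it makes the definite description in \<open>christoffel\<close>
  meaningful.\<close>

lemma ex1_inner_product_representation:
  fixes L :: "'e::euclidean_space \<Rightarrow> real"
  assumes b: "inner_product b" and L: "linear L"
  shows "\<exists>!w. \<forall>z. b w z = L z"
proof -
  note bil = inner_product_bilinear[OF b]
  define E where "E = some_onb b UNIV"
  have E: "orthonormal_basis_of b UNIV E"
    unfolding E_def by (rule some_onb[OF b]) simp
  have "b (\<Sum>e\<in>E. L e *\<^sub>R e) z = L z" for z
  proof -
    have "L z = L (\<Sum>e\<in>E. b z e *\<^sub>R e)"
      by (intro arg_cong[of _ _ L] orthonormal_basis_expansion[OF b E]) simp
    also have "\<dots> = b (\<Sum>e\<in>E. L e *\<^sub>R e) z"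
      by (simp add: linear_sum[OF L] linear_cmul[OF L] bilinear_sum_left[OF bil] bilinear_lmul[OF bil]
          inner_product_commute[OF b, of z] mult.commute)
    finally show ?thesis by simp
  qed
  then show ?thesis
    using inner_product_eqI[OF b] by (metis (no_types, lifting))
qed

text \<open>Two candidates differ by a vector that lies in \<open>T\<close> and is orthogonal to
  \<open>T\<close>, so exhibiting one candidate determines the normal part.\<close>

lemma normal_part_eqI:
  assumes b: "inner_product b" and T: "subspace T"
    and "z - w \<in> T" and "\<And>t. t \<in> T \<Longrightarrow> b w t = 0"
  shows "normal_part b T z = w"
  unfolding normal_part_def
proof (rule the_equality)
  note bil = inner_product_bilinear[OF b]
  show "z - w \<in> T \<and> (\<forall>t\<in>T. b w t = 0)" using assms by simp
  fix w' assume w': "z - w' \<in> T \<and> (\<forall>t\<in>T. b w' t = 0)"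
  have "w' - w \<in> T"
    using subspace_diff[OF T \<open>z - w \<in> T\<close>, of "z - w'"] w' by simp
  then have "b (w' - w) (w' - w) = 0"
    using w' assms(4) by (simp add: bilinear_lsub[OF bil])
  then show "w' = w"
    using inner_product_eq_0_iff[OF b] by simp
qed

section \<open>Sums over unordered pairs\<close>

lemma sum_square_symmetric:
  fixes F :: "nat \<Rightarrow> nat \<Rightarrow> real"
  assumes "\<And>i j. F i j = F j i"
  shows "(\<Sum>i=1..k. \<Sum>j=1..k. F i j) = (\<Sum>i=1..k. F i i) + 2 * (\<Sum>i=1..k. \<Sum>j=Suc i..k. F i j)"
proof (induction k)
  case 0
  then show ?case by simp
next
  case (Suc k)
  have "(\<Sum>i=1..k. \<Sum>j=Suc i..Suc k. F i j) = (\<Sum>i=1..k. (\<Sum>j=Suc i..k. F i j) + F i (Suc k))"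
    by (intro sum.cong) auto
  moreover have "(\<Sum>j=1..k. F (Suc k) j) = (\<Sum>j=1..k. F j (Suc k))"
    using assms by (rule sum.cong[OF refl])
  ultimately show ?case
    using Suc by (simp add: sum.distrib)
qed

text \<open>With \<open>d\<close> the sum of the squared lengths, expanding squares gives
  \<open>h = d + 2 * P\<close> and \<open>Q = k * d - h\<close>. Eliminating \<open>d\<close> leaves
  \<open>2 * k * P = (k - 1) * h - Q\<close>, which is where the factor (k - 1)/(2k)
  originates.\<close>

lemma sum_inner_product_pairs:
  fixes H :: "nat \<Rightarrow> 'f::real_vector"
  assumes b: "inner_product b" and k: "k > 0"
  shows "(\<Sum>i=1..k. \<Sum>j=Suc i..k. b (H i) (H j)) =
    (real k - 1) / (2 * real k) * b (\<Sum>i=1..k. H i) (\<Sum>i=1..k. H i)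
     - (\<Sum>i=1..k. \<Sum>j=Suc i..k. b (H i - H j) (H i - H j)) / (2 * real k)"
proof -
  note bil = inner_product_bilinear[OF b]
  define P where "P = (\<Sum>i=1..k. \<Sum>j=Suc i..k. b (H i) (H j))"
  define Q where "Q = (\<Sum>i=1..k. \<Sum>j=Suc i..k. b (H i - H j) (H i - H j))"
  define d where "d = (\<Sum>i=1..k. b (H i) (H i))"
  define h where "h = b (\<Sum>i=1..k. H i) (\<Sum>i=1..k. H i)"
  have h: "h = (\<Sum>i=1..k. \<Sum>j=1..k. b (H i) (H j))"
    by (simp only: h_def bilinear_sum_left[OF bil] bilinear_sum_right[OF bil]) (rule sum.swap)
  then have 1: "h = d + 2 * P"
    unfolding d_def P_def using sum_square_symmetric[of "\<lambda>i j. b (H i) (H j)" k] inner_product_commute[OF b]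
    by metis
  have sq: "b (u - v) (u - v) = b u u + b v v - 2 * b u v" for u v
    using inner_product_commute[OF b, of v u] by (simp add: bilinear_lsub[OF bil] bilinear_rsub[OF bil])
  \<comment> \<open>The sum over all ordered pairs counts each unordered pair twice, and its
    diagonal terms vanish.\<close>
  have "2 * Q = (\<Sum>i=1..k. \<Sum>j=1..k. b (H i - H j) (H i - H j))"
    unfolding Q_def
    by (subst sum_square_symmetric) (auto simp: sq bilinear_lzero[OF bil] inner_product_commute[OF b])
  also have "\<dots> = 2 * k * d - 2 * h"
    by (simp add: sq sum.distrib sum_subtractf h d_def flip: sum_distrib_left)
  finally have 2: "Q = k * d - h" by simp
  have "(real k - 1) * h - Q = 2 * k * P"
    by (simp add: 1 2 algebra_simps)
  then have "P = ((real k - 1) * h - Q) / (2 * real k)"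
    using k by simp
  then have "P = (real k - 1) / (2 * real k) * h - Q / (2 * real k)"
    by (metis diff_divide_distrib times_divide_eq_left)
  then show ?thesis unfolding P_def Q_def h_def .
qed

section \<open>Directional derivatives\<close>

abbreviation der :: "('e::euclidean_space \<Rightarrow> 'f::real_normed_vector) \<Rightarrow> 'e \<Rightarrow> 'e \<Rightarrow> 'f" where
  "der F x u \<equiv> frechet_derivative F (at x) u"

lemma smooth_on_differentiable: "smooth_on S F \<Longrightarrow> x \<in> S \<Longrightarrow> F differentiable (at x)"
  unfolding smooth_on_def by (metis Ck_on.simps(2))

lemma smooth_on_der: "smooth_on S F \<Longrightarrow> smooth_on S (\<lambda>x. der F x v)"
  unfolding smooth_on_def by (metis Ck_on.simps(2))

lemma has_derivative_der: "F differentiable (at x) \<Longrightarrow> (F has_derivative der F x) (at x)"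
  by (simp add: frechet_derivative_works)

lemma der_eqI: "(F has_derivative F') (at x) \<Longrightarrow> der F x u = F' u"
  by (metis frechet_derivative_at)

lemma der_transform_within_open:
  assumes "F differentiable (at x)" "open S" "x \<in> S" "\<And>y. y \<in> S \<Longrightarrow> F y = F' y"
  shows "der F x u = der F' x u"
  using frechet_derivative_transform_within_open[OF assms] by simp

text \<open>A product rule that asks for differentiability of \<open>P\<close> only with its two
  arguments frozen. Expanding both arguments in the standard basis reduces it to finitely many
  products of scalar functions with such frozen fields. It serves for the metric and for the
  Christoffel symbols along a map.\<close>

lemma has_derivative_bilinear_field:
  fixes P :: "'g::real_normed_vector \<Rightarrow> 'f::euclidean_space \<Rightarrow> 'h::euclidean_space \<Rightarrow> 'k::real_normed_vector"
  assumes bil: "\<And>y. y \<in> W \<Longrightarrow> bilinear (P y)"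
    and P: "\<And>i j. ((\<lambda>y. P y i j) has_derivative P' i j) (at (F x))"
    and F: "(F has_derivative F') (at x)"
    and a: "(a has_derivative a') (at x)" and b: "(b has_derivative b') (at x)"
    and W: "open W" "F x \<in> W"
  shows "((\<lambda>y. P (F y) (a y) (b y)) has_derivative
    (\<lambda>u. P' (a x) (b x) (F' u) + P (F x) (a' u) (b x) + P (F x) (a x) (b' u))) (at x)"
proof -
  have exp: "P y v w = (\<Sum>i\<in>Basis. \<Sum>j\<in>Basis. ((v \<bullet> i) * (w \<bullet> j)) *\<^sub>R P y i j)" if "y \<in> W" for y v w
  proof -
    have "P y v w = P y (\<Sum>i\<in>Basis. (v \<bullet> i) *\<^sub>R i) (\<Sum>j\<in>Basis. (w \<bullet> j) *\<^sub>R j)"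
      by (simp add: euclidean_representation)
    also have "\<dots> = (\<Sum>i\<in>Basis. \<Sum>j\<in>Basis. ((v \<bullet> i) * (w \<bullet> j)) *\<^sub>R P y i j)"
      by (simp only: bilinear_sum_left[OF bil[OF that]] bilinear_sum_right[OF bil[OF that]]
          bilinear_lmul[OF bil[OF that]] bilinear_rmul[OF bil[OF that]] scaleR_scaleR scaleR_sum_right)
        (subst sum.swap, simp add: mult.commute)
    finally show ?thesis .
  qed
  define Q where "Q = (\<lambda>y. \<Sum>i\<in>Basis. \<Sum>j\<in>Basis. ((a y \<bullet> i) * (b y \<bullet> j)) *\<^sub>R P (F y) i j)"
  have PF: "((\<lambda>y. P (F y) i j) has_derivative (\<lambda>u. P' i j (F' u))) (at x)" for i j
    using diff_chain_at[OF F P] by (simp add: o_def)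
  have Q: "(Q has_derivative (\<lambda>u. \<Sum>i\<in>Basis. \<Sum>j\<in>Basis.
        ((a x \<bullet> i) * (b x \<bullet> j)) *\<^sub>R P' i j (F' u)
        + ((a x \<bullet> i) * (b' u \<bullet> j) + (a' u \<bullet> i) * (b x \<bullet> j)) *\<^sub>R P (F x) i j)) (at x)"
    unfolding Q_def by (intro derivative_eq_intros PF a b) (auto intro!: a b PF)
  \<comment> \<open>\<open>P'\<close> is given separately for each pair of arguments; uniqueness of
    derivatives forces it to follow the same basis expansion as \<open>P\<close>.\<close>
  have P'_exp: "P' v w = (\<lambda>h. \<Sum>i\<in>Basis. \<Sum>j\<in>Basis. ((v \<bullet> i) * (w \<bullet> j)) *\<^sub>R P' i j h)" for v w
  proof -
    have "((\<lambda>y. \<Sum>i\<in>Basis. \<Sum>j\<in>Basis. ((v \<bullet> i) * (w \<bullet> j)) *\<^sub>R P y i j) has_derivative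
        (\<lambda>h. \<Sum>i\<in>Basis. \<Sum>j\<in>Basis. ((v \<bullet> i) * (w \<bullet> j)) *\<^sub>R P' i j h)) (at (F x))"
      by (intro has_derivative_sum has_derivative_scaleR_right P)
    then have "((\<lambda>y. P y v w) has_derivative
        (\<lambda>h. \<Sum>i\<in>Basis. \<Sum>j\<in>Basis. ((v \<bullet> i) * (w \<bullet> j)) *\<^sub>R P' i j h)) (at (F x))"
      by (rule has_derivative_transform_within_open[OF _ W]) (simp add: exp)
    with P show ?thesis by (rule has_derivative_unique)
  qed
  \<comment> \<open>Bilinearity, and with it the expansion, is available on \<open>W\<close> only;
    continuity of \<open>F\<close> keeps nearby points inside.\<close>
  have "\<forall>\<^sub>F y in at x. F y \<in> W"
    using has_derivative_continuous[OF F] W by (auto simp: continuous_within intro: topological_tendstoD)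
  then have "\<forall>\<^sub>F y in at x. Q y = P (F y) (a y) (b y)"
    by eventually_elim (simp add: exp Q_def)
  then have "((\<lambda>y. P (F y) (a y) (b y)) has_derivative (\<lambda>u. \<Sum>i\<in>Basis. \<Sum>j\<in>Basis.
        ((a x \<bullet> i) * (b x \<bullet> j)) *\<^sub>R P' i j (F' u)
        + ((a x \<bullet> i) * (b' u \<bullet> j) + (a' u \<bullet> i) * (b x \<bullet> j)) *\<^sub>R P (F x) i j)) (at x)"
    by (rule has_derivative_transform_eventually[OF Q]) (simp_all add: exp[OF W(2), symmetric] Q_def)
  moreover have "P' (a x) (b x) (F' u) + P (F x) (a' u) (b x) + P (F x) (a x) (b' u)
      = (\<Sum>i\<in>Basis. \<Sum>j\<in>Basis.
        ((a x \<bullet> i) * (b x \<bullet> j)) *\<^sub>R P' i j (F' u)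
        + ((a x \<bullet> i) * (b' u \<bullet> j) + (a' u \<bullet> i) * (b x \<bullet> j)) *\<^sub>R P (F x) i j)" for u
    by (subst P'_exp, subst (1 2) exp[OF W(2)]) (simp add: sum.distrib scaleR_add_left algebra_simps)
  ultimately show ?thesis by simp
qed

section \<open>Symmetry of second derivatives\<close>

text \<open>The second difference \<open>f (x + tu + tv) - f (x + tu) - f (x + tv) + f x\<close>, divided by \<open>t\<^sup>2\<close>,
  tends to \<open>\<partial>\<^sub>v \<partial>\<^sub>u f\<close> by the mean value theorem, and it is symmetric in \<open>u\<close> and \<open>v\<close>.\<close>

lemma second_difference_tendsto:
  fixes f :: "'e::euclidean_space \<Rightarrow> real"
  assumes S: "open S" "x \<in> S" and f: "\<And>y. y \<in> S \<Longrightarrow> f differentiable (at y)"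
    and fu: "(\<lambda>y. der f y u) differentiable (at x)"
  shows "((\<lambda>t. (f (x + t *\<^sub>R u + t *\<^sub>R v) - f (x + t *\<^sub>R u) - f (x + t *\<^sub>R v) + f x) / t\<^sup>2)
    \<longlongrightarrow> der (\<lambda>y. der f y u) x v) (at_right 0)"
proof (rule tendstoI)
  fix e :: real assume e: "e > 0"
  define L where "L = der (\<lambda>y. der f y u) x"
  \<comment> \<open>All points involved differ from \<open>x\<close> by at most
    \<open>t * C\<close>; the summand 1 keeps \<open>C\<close> positive when
    \<open>u = v = 0\<close>.\<close>
  define C where "C = norm u + norm v + 1"
  have C: "C > 0" "norm u + norm v \<le> C" by (auto simp: C_def add_nonneg_pos)
  have L: "((\<lambda>y. der f y u) has_derivative L) (at x)"
    unfolding L_def using fu by (rule has_derivative_der)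
  then have lin: "linear L" by (rule has_derivative_linear)
  obtain r where r: "r > 0" "ball x r \<subseteq> S"
    using S openE by blast
  obtain d where d: "d > 0" "\<And>y. norm (y - x) < d \<Longrightarrow>
      \<bar>der f y u - der f x u - L (y - x)\<bar> \<le> e / (4 * C) * norm (y - x)"
    using L e C(1) unfolding has_derivative_at_alt
    by (metis real_norm_def divide_pos_pos mult_pos_pos zero_less_numeral)
  define m where "m = min r d / C"
  have m: "m > 0" using r d C by (simp add: m_def)
  have "\<bar>(f (x + t *\<^sub>R u + t *\<^sub>R v) - f (x + t *\<^sub>R u) - f (x + t *\<^sub>R v) + f x) / t\<^sup>2 - L v\<bar> < e"
    if t: "0 < t" "t < m" for t
  proof -
    have tC: "t * C < r" "t * C < d"
      using t C by (auto simp: m_def field_simps)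
    have bd: "norm (s *\<^sub>R u + t' *\<^sub>R v) \<le> t * C" if "\<bar>s\<bar> \<le> t" "\<bar>t'\<bar> \<le> t" for s t'
    proof -
      have "norm (s *\<^sub>R u + t' *\<^sub>R v) \<le> \<bar>s\<bar> * norm u + \<bar>t'\<bar> * norm v"
        by (metis norm_scaleR norm_triangle_ineq)
      also have "\<dots> \<le> t * norm u + t * norm v"
        using that by (intro add_mono mult_right_mono) auto
      also have "\<dots> \<le> t * C"
        using C t by (metis distrib_left less_imp_le mult_left_mono)
      finally show ?thesis .
    qed
    have inS: "x + (s *\<^sub>R u + t' *\<^sub>R v) \<in> S" if "\<bar>s\<bar> \<le> t" "\<bar>t'\<bar> \<le> t" for s t'
    proof -
      have "dist x (x + (s *\<^sub>R u + t' *\<^sub>R v)) < r"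
        using bd[OF that] tC by (metis add_diff_cancel_left' dist_commute dist_norm le_less_trans)
      then show ?thesis using r(2) by auto
    qed
    \<comment> \<open>The difference in direction \<open>v\<close>, as a function of the
      displacement along \<open>u\<close>: the second difference is \<open>g t - g 0\<close>, and
      the mean value theorem turns it into a difference of two values of
      \<open>der f _ u\<close>.\<close>
    define g where "g = (\<lambda>s. f (x + s *\<^sub>R u + t *\<^sub>R v) - f (x + s *\<^sub>R u))"
    have dg: "(g has_derivative (\<lambda>h. h * (der f (x + s *\<^sub>R u + t *\<^sub>R v) u - der f (x + s *\<^sub>R u) u))) (at s)"
      if "0 \<le> s" "s \<le> t" for s
    proof -
      have 1: "f differentiable (at (x + s *\<^sub>R u + t *\<^sub>R v))"
        using f[OF inS[of s t]] that by (simp add: add.assoc)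
      have 2: "f differentiable (at (x + s *\<^sub>R u))"
        using f[OF inS[of s 0]] that by simp
      have 3: "((\<lambda>s. x + s *\<^sub>R u + t *\<^sub>R v) has_derivative (\<lambda>h. h *\<^sub>R u)) (at s)"
        "((\<lambda>s. x + s *\<^sub>R u) has_derivative (\<lambda>h. h *\<^sub>R u)) (at s)"
        by (auto intro!: derivative_eq_intros)
      show ?thesis
        unfolding g_def
        using has_derivative_diff[OF diff_chain_at[OF 3(1) has_derivative_der[OF 1]]
            diff_chain_at[OF 3(2) has_derivative_der[OF 2]]]
          linear_cmul[OF linear_frechet_derivative[OF 1]] linear_cmul[OF linear_frechet_derivative[OF 2]]
        by (simp add: o_def right_diff_distrib)
    qed
    obtain s where s: "0 < s" "s < t"
      and mv: "g t - g 0 = t * (der f (x + s *\<^sub>R u + t *\<^sub>R v) u - der f (x + s *\<^sub>R u) u)"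
      using mvt_simple[OF t(1), of g "\<lambda>s h. h * (der f (x + s *\<^sub>R u + t *\<^sub>R v) u - der f (x + s *\<^sub>R u) u)"]
        has_derivative_at_withinI[OF dg] by auto
    have est: "\<bar>der f (x + w) u - der f x u - L w\<bar> \<le> e / 4 * t" if "norm w \<le> t * C" for w
    proof -
      have "\<bar>der f (x + w) u - der f x u - L w\<bar> \<le> e / (4 * C) * norm w"
        using d(2)[of "x + w"] that tC by simp
      also have "\<dots> \<le> e / (4 * C) * (t * C)"
        using that e C by (intro mult_left_mono) auto
      finally show ?thesis using C by simp
    qed
    \<comment> \<open>Both values are compared with the linearization of \<open>der f _ u\<close> at
      \<open>x\<close>. The unknown \<open>s\<close> enters both through
      \<open>s *\<^sub>R L u\<close>, which cancels in the difference; two errors of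
      \<open>e / 4 * t\<close> remain.\<close>
    have e1: "\<bar>der f (x + s *\<^sub>R u + t *\<^sub>R v) u - der f x u - (s *\<^sub>R L u + t *\<^sub>R L v)\<bar> \<le> e / 4 * t"
      using est[OF bd[of s t]] s by (simp add: linear_add[OF lin] linear_cmul[OF lin] add.assoc)
    have e2: "\<bar>der f (x + s *\<^sub>R u) u - der f x u - s *\<^sub>R L u\<bar> \<le> e / 4 * t"
      using est[OF bd[of s 0]] s by (simp add: linear_cmul[OF lin])
    have "\<bar>(g t - g 0) / t\<^sup>2 - L v\<bar> = \<bar>der f (x + s *\<^sub>R u + t *\<^sub>R v) u - der f (x + s *\<^sub>R u) u - t * L v\<bar> / t"
    proof -
      have "(g t - g 0) / t\<^sup>2 - L v = (der f (x + s *\<^sub>R u + t *\<^sub>R v) u - der f (x + s *\<^sub>R u) u - t * L v) / t"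
        using t by (simp add: mv power2_eq_square field_simps)
      then show ?thesis using t by simp
    qed
    also have "\<dots> \<le> (e / 2 * t) / t"
    proof (rule divide_right_mono)
      show "\<bar>der f (x + s *\<^sub>R u + t *\<^sub>R v) u - der f (x + s *\<^sub>R u) u - t * L v\<bar> \<le> e / 2 * t"
        using e1 e2 unfolding real_scaleR_def abs_le_iff by linarith
    qed (use t in simp)
    also have "\<dots> < e" using e t by simp
    finally show ?thesis by (simp add: g_def algebra_simps)
  qed
  then have "\<forall>t>0. t < m \<longrightarrow>
      dist ((f (x + t *\<^sub>R u + t *\<^sub>R v) - f (x + t *\<^sub>R u) - f (x + t *\<^sub>R v) + f x) / t\<^sup>2) (L v) < e"
    by (simp add: dist_real_def)
  then show "\<forall>\<^sub>F t in at_right 0.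
      dist ((f (x + t *\<^sub>R u + t *\<^sub>R v) - f (x + t *\<^sub>R u) - f (x + t *\<^sub>R v) + f x) / t\<^sup>2)
        (der (\<lambda>y. der f y u) x v) < e"
    unfolding L_def eventually_at_right[OF m] using m by blast
qed

lemma der_inner:
  fixes f :: "'e::euclidean_space \<Rightarrow> 'f::euclidean_space"
  assumes "f differentiable (at x)"
  shows "(\<lambda>y. f y \<bullet> b) differentiable (at x)" "der (\<lambda>y. f y \<bullet> b) x u = der f x u \<bullet> b"
proof -
  have "((\<lambda>y. f y \<bullet> b) has_derivative (\<lambda>u. der f x u \<bullet> b)) (at x)"
    using has_derivative_der[OF assms] by (rule has_derivative_inner_left)
  then show "(\<lambda>y. f y \<bullet> b) differentiable (at x)" "der (\<lambda>y. f y \<bullet> b) x u = der f x u \<bullet> b"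
    by (auto simp: differentiable_def der_eqI)
qed

text \<open>Both mixed derivatives are limits of the same symmetric second difference. The argument
  runs componentwise because the mean value theorem needs real values. Stated for a general
  \<open>f\<close>, it applies to \<open>F\<close> and also to its directional derivatives.\<close>

lemma der_der_commute:
  fixes f :: "'e::euclidean_space \<Rightarrow> 'f::euclidean_space"
  assumes S: "open S" "x \<in> S" and f: "\<And>y. y \<in> S \<Longrightarrow> f differentiable (at y)"
    and fu: "\<And>u. (\<lambda>y. der f y u) differentiable (at x)"
  shows "der (\<lambda>y. der f y u) x v = der (\<lambda>y. der f y v) x u"
proof (rule euclidean_eqI)
  fix b :: 'f
  define fb where "fb = (\<lambda>y. f y \<bullet> b)"
  have fb: "fb differentiable (at y)" "der fb y w = der f y w \<bullet> b" if "y \<in> S" for y w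
    unfolding fb_def using der_inner[OF f[OF that]] by auto
  have fbd: "(\<lambda>y. der fb y w) differentiable (at x)"
      "der (\<lambda>y. der fb y w) x w' = der (\<lambda>y. der f y w) x w' \<bullet> b" for w w'
  proof -
    have "((\<lambda>y. der f y w \<bullet> b) has_derivative (\<lambda>h. der (\<lambda>y. der f y w) x h \<bullet> b)) (at x)"
      using has_derivative_der[OF fu] by (rule has_derivative_inner_left)
    then have *: "((\<lambda>y. der fb y w) has_derivative (\<lambda>h. der (\<lambda>y. der f y w) x h \<bullet> b)) (at x)"
      by (rule has_derivative_transform_within_open[OF _ S]) (simp add: fb)
    show "(\<lambda>y. der fb y w) differentiable (at x)"
      "der (\<lambda>y. der fb y w) x w' = der (\<lambda>y. der f y w) x w' \<bullet> b"
      using * by (auto simp: differentiable_def der_eqI)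
  qed
  have "der (\<lambda>y. der fb y u) x v = der (\<lambda>y. der fb y v) x u"
  proof (rule tendsto_unique)
    show "((\<lambda>t. (fb (x + t *\<^sub>R u + t *\<^sub>R v) - fb (x + t *\<^sub>R u) - fb (x + t *\<^sub>R v) + fb x) / t\<^sup>2)
        \<longlongrightarrow> der (\<lambda>y. der fb y u) x v) (at_right 0)"
      using S fb(1) fbd(1) by (rule second_difference_tendsto)
    have "((\<lambda>t. (fb (x + t *\<^sub>R v + t *\<^sub>R u) - fb (x + t *\<^sub>R v) - fb (x + t *\<^sub>R u) + fb x) / t\<^sup>2)
        \<longlongrightarrow> der (\<lambda>y. der fb y v) x u) (at_right 0)"
      using S fb(1) fbd(1) by (rule second_difference_tendsto)
    then show "((\<lambda>t. (fb (x + t *\<^sub>R u + t *\<^sub>R v) - fb (x + t *\<^sub>R u) - fb (x + t *\<^sub>R v) + fb x) / t\<^sup>2)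
        \<longlongrightarrow> der (\<lambda>y. der fb y v) x u) (at_right 0)"
      by (simp add: algebra_simps)
  qed simp
  then show "der (\<lambda>y. der f y u) x v \<bullet> b = der (\<lambda>y. der f y v) x u \<bullet> b"
    by (simp add: fbd)
qed

section \<open>Differentiating implicit and bilinear data\<close>

text \<open>The solution \<open>w\<close> of the linear system \<open>G y (w y) z = l y z\<close> is differentiable: from
  \<open>G y (w y - w x) z = l y z - G y (w x) z\<close> and the local boundedness of the inverse of \<open>G y\<close>.\<close>

lemma differentiable_representative:
  fixes G :: "'e::euclidean_space \<Rightarrow> 'e \<Rightarrow> 'e \<Rightarrow> real"
  assumes S: "open S" "x \<in> S" and G: "\<And>y. y \<in> S \<Longrightarrow> inner_product (G y)"
    and dG: "\<And>u v. (\<lambda>y. G y u v) differentiable (at x)"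
    and dl: "\<And>z. (\<lambda>y. l y z) differentiable (at x)"
    and w: "\<And>y z. y \<in> S \<Longrightarrow> G y (w y) z = l y z"
  shows "w differentiable (at x)"
proof -
  have bilx: "bilinear (G x)" by (rule inner_product_bilinear[OF G[OF S(2)]])
  \<comment> \<open>\<open>T\<close> is the Gram operator of \<open>G x\<close> with respect to the
    standard inner product. Its lower bound \<open>B\<close> is the bound on the inverse.\<close>
  define T where "T = (\<lambda>h. \<Sum>j\<in>Basis. G x h j *\<^sub>R j)"
  have linT: "linear T"
    by (rule linearI) (simp_all add: T_def bilinear_ladd[OF bilx] bilinear_lmul[OF bilx]
        scaleR_add_left sum.distrib scaleR_sum_right)
  have Tj: "T h \<bullet> j = G x h j" if "j \<in> Basis" for h j
    using that by (simp add: T_def)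
  have Tz: "T h \<bullet> z = G x h z" for h z
  proof -
    have "T h \<bullet> z = (\<Sum>j\<in>Basis. (z \<bullet> j) * G x h j)"
      by (subst euclidean_inner) (simp add: Tj mult.commute)
    also have "\<dots> = G x h (\<Sum>j\<in>Basis. (z \<bullet> j) *\<^sub>R j)"
      by (simp only: bilinear_sum_right[OF bilx] bilinear_rmul[OF bilx] real_scaleR_def)
    finally show ?thesis by (simp add: euclidean_representation)
  qed
  have "inj T"
  proof (subst linear_injective_0[OF linT], intro allI impI)
    fix h assume "T h = 0"
    then have "G x h h = 0" using Tz[of h h] by simp
    then show "h = 0" using inner_product_eq_0_iff[OF G[OF S(2)]] by simp
  qed
  then obtain B where B: "B > 0" "\<And>h. B * norm h \<le> norm (T h)"
    using linear_inj_bounded_below_pos[OF linT] by blast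
  obtain T' where T': "linear T'" "\<And>z. T (T' z) = z"
    using linear_injective_isomorphism[OF linT \<open>inj T\<close>] by blast
  \<comment> \<open>The right-hand side of the system for the increment \<open>w y - w x\<close>; it
    vanishes at \<open>y = x\<close>.\<close>
  define m where "m = (\<lambda>j y. l y j - G y (w x) j)"
  have dm: "m j differentiable (at x)" for j
    unfolding m_def by (intro differentiable_diff dl dG)
  \<comment> \<open>The candidate derivative solves the system at \<open>x\<close> with the
    linearized right-hand side.\<close>
  define w' where "w' = (\<lambda>h. T' (\<Sum>j\<in>Basis. der (m j) x h *\<^sub>R j))"
  have linw': "linear w'"
    unfolding w'_def
    by (intro linear_compose[OF _ T'(1), unfolded o_def] linearI)
      (simp_all add: linear_add[OF linear_frechet_derivative[OF dm]]
        linear_cmul[OF linear_frechet_derivative[OF dm]] scaleR_add_left sum.distrib scaleR_sum_right)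
  have Gw': "G x (w' h) j = der (m j) x h" if "j \<in> Basis" for j h
    using that by (simp add: w'_def T' flip: Tj)
  obtain K where K: "\<And>h. norm (w' h) \<le> K * norm h"
    using linear_bounded[OF linw'] by blast
  \<comment> \<open>\<open>\<phi>\<close> measures how far the matrix of \<open>G y\<close> is from
    that of \<open>G x\<close>; \<open>\<psi>\<close> below collects the relative linearization
    errors of the \<open>m j\<close>. Both tend to 0, and together they control the remainder
    \<open>r\<close>.\<close>
  define \<phi> where "\<phi> = (\<lambda>y. \<Sum>j\<in>Basis. \<Sum>i\<in>Basis. \<bar>G y i j - G x i j\<bar>)"
  have diff: "(\<Sum>j\<in>Basis. \<bar>G y h j - G x h j\<bar>) \<le> norm h * \<phi> y" if y: "y \<in> S" for y h
  proof -
    note bily = inner_product_bilinear[OF G[OF y]]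
    have "\<bar>G y h j - G x h j\<bar> \<le> norm h * (\<Sum>i\<in>Basis. \<bar>G y i j - G x i j\<bar>)" for j
    proof -
      have *: "b h j = (\<Sum>i\<in>Basis. (h \<bullet> i) * b i j)" if "bilinear b" for b :: "'e \<Rightarrow> 'e \<Rightarrow> real"
        by (subst (1) euclidean_representation[symmetric])
          (simp only: bilinear_sum_left[OF that] bilinear_lmul[OF that] real_scaleR_def)
      have "\<bar>G y h j - G x h j\<bar> = \<bar>\<Sum>i\<in>Basis. (h \<bullet> i) * (G y i j - G x i j)\<bar>"
        by (simp add: *[OF bily] *[OF bilx] right_diff_distrib sum_subtractf)
      also have "\<dots> \<le> (\<Sum>i\<in>Basis. \<bar>(h \<bullet> i) * (G y i j - G x i j)\<bar>)"
        by (rule sum_abs)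
      also have "\<dots> \<le> (\<Sum>i\<in>Basis. norm h * \<bar>G y i j - G x i j\<bar>)"
        by (intro sum_mono) (simp add: abs_mult Basis_le_norm mult_right_mono)
      finally show ?thesis by (simp add: sum_distrib_left)
    qed
    then show ?thesis
      unfolding \<phi>_def sum_distrib_left by (intro sum_mono) (simp add: sum_distrib_left)
  qed
  have \<phi>0: "(\<phi> \<longlongrightarrow> 0) (at x)"
  proof -
    have "((\<lambda>y. G y i j) \<longlongrightarrow> G x i j) (at x)" for i j
      using differentiable_imp_continuous_within[OF dG] by (simp add: continuous_within)
    then have "(\<phi> \<longlongrightarrow> (\<Sum>j\<in>Basis. \<Sum>i\<in>Basis. \<bar>G x i j - G x i j\<bar>)) (at x)"
      unfolding \<phi>_def by (intro tendsto_intros)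
    then show ?thesis by simp
  qed
  define \<psi> where "\<psi> = (\<lambda>y. \<Sum>j\<in>Basis. norm (m j y - m j x - der (m j) x (y - x)) / norm (y - x))"
  have \<psi>0: "(\<psi> \<longlongrightarrow> 0) (at x)"
  proof -
    have "((\<lambda>y. norm (m j y - m j x - der (m j) x (y - x)) / norm (y - x)) \<longlongrightarrow> 0) (at x)" for j
      using has_derivative_der[OF dm] by (simp add: has_derivative_iff_norm)
    then have "(\<psi> \<longlongrightarrow> (\<Sum>j\<in>(Basis::'e set). 0)) (at x)"
      unfolding \<psi>_def by (intro tendsto_sum)
    then show ?thesis by simp
  qed
  define r where "r = (\<lambda>y. w y - w x - w' (y - x))"
  have main: "norm (norm (r y) / norm (y - x)) \<le> 2 / B * (\<psi> y + K * \<phi> y)"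
    if y: "y \<in> S" "y \<noteq> x" "\<phi> y < B / 2" for y
  proof -
    define h where "h = y - x"
    have h: "norm h > 0" using y by (simp add: h_def)
    note bily = inner_product_bilinear[OF G[OF y(1)]]
    have Gr: "\<bar>G y (r y) j\<bar> \<le> \<bar>m j y - m j x - der (m j) x h\<bar> + \<bar>G y (w' h) j - G x (w' h) j\<bar>"
      if "j \<in> Basis" for j
    proof -
      have "G y (r y) j = m j y - G y (w' h) j"
        using w[OF y(1)] by (simp add: r_def h_def m_def bilinear_lsub[OF bily])
      moreover have "m j x = 0" using w[OF S(2)] by (simp add: m_def)
      ultimately show ?thesis using Gw'[OF that, of h] by simp
    qed
    have "B * norm (r y) \<le> norm (T (r y))" by (rule B)
    also have "\<dots> \<le> (\<Sum>j\<in>Basis. \<bar>G x (r y) j\<bar>)"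
      using norm_le_l1[of "T (r y)"] by (simp add: Tj)
    also have "\<dots> \<le> (\<Sum>j\<in>Basis. \<bar>G y (r y) j\<bar> + \<bar>G y (r y) j - G x (r y) j\<bar>)"
      by (intro sum_mono) linarith
    also have "\<dots> \<le> (\<Sum>j\<in>Basis. \<bar>G y (r y) j\<bar>) + norm (r y) * \<phi> y"
      using diff[OF y(1)] by (simp add: sum.distrib)
    also have "(\<Sum>j\<in>Basis. \<bar>G y (r y) j\<bar>)
        \<le> (\<Sum>j\<in>Basis. \<bar>m j y - m j x - der (m j) x h\<bar> + \<bar>G y (w' h) j - G x (w' h) j\<bar>)"
      by (intro sum_mono Gr)
    also have "\<dots> \<le> norm h * \<psi> y + norm (w' h) * \<phi> y"
      using diff[OF y(1), of "w' h"] h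
      by (simp add: sum.distrib \<psi>_def flip: h_def sum_divide_distrib)
    also have "norm (w' h) * \<phi> y \<le> K * norm h * \<phi> y"
      by (intro mult_right_mono K) (simp add: \<phi>_def sum_nonneg)
    \<comment> \<open>The remainder occurs on the right as well; \<open>\<phi> y < B / 2\<close>
      lets half of the left-hand side absorb it.\<close>
    also have "norm (r y) * \<phi> y \<le> norm (r y) * (B / 2)"
      using y by (intro mult_left_mono) auto
    finally have "B / 2 * norm (r y) \<le> norm h * (\<psi> y + K * \<phi> y)"
      by (simp add: algebra_simps)
    then have "norm (r y) / norm h \<le> 2 / B * (\<psi> y + K * \<phi> y)"
      using h B(1) by (simp add: field_simps)
    then show ?thesis by (simp add: h_def)
  qed
  have "\<forall>\<^sub>F y in at x. y \<in> S \<and> y \<noteq> x \<and> \<phi> y < B / 2"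
    using eventually_at_in_open[OF S] order_tendstoD(2)[OF \<phi>0, of "B / 2"] B(1)
    by (auto elim: eventually_elim2)
  then have "\<forall>\<^sub>F y in at x. norm (norm (r y) / norm (y - x)) \<le> 2 / B * (\<psi> y + K * \<phi> y)"
    by eventually_elim (use main in blast)
  moreover have "((\<lambda>y. 2 / B * (\<psi> y + K * \<phi> y)) \<longlongrightarrow> 0) (at x)"
    using B(1) by (auto intro!: tendsto_eq_intros \<psi>0 \<phi>0)
  ultimately have "((\<lambda>y. norm (r y) / norm (y - x)) \<longlongrightarrow> 0) (at x)"
    by (rule Lim_null_comparison)
  then have "(w has_derivative w') (at x)"
    using linw' by (simp add: has_derivative_iff_norm r_def linear_conv_bounded_linear)
  then show ?thesis by (auto simp: differentiable_def)
qed

text \<open>Additivity and homogeneity hold on a neighbourhood of \<open>x\<close>, so they may be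
  differentiated.\<close>

lemma bilinear_der:
  fixes P :: "'g::euclidean_space \<Rightarrow> 'f::real_vector \<Rightarrow> 'h::real_vector \<Rightarrow> 'k::euclidean_space"
  assumes S: "open S" "x \<in> S" and bil: "\<And>y. y \<in> S \<Longrightarrow> bilinear (P y)"
    and P: "\<And>u v. (\<lambda>y. P y u v) differentiable (at x)"
  shows "bilinear (\<lambda>u v. der (\<lambda>y. P y u v) x h)"
proof -
  note dP = has_derivative_der[OF P]
  have "der (\<lambda>y. P y (u + u') v) x h = der (\<lambda>y. P y u v) x h + der (\<lambda>y. P y u' v) x h" for u u' v
    by (intro der_eqI has_derivative_transform_within_open[OF has_derivative_add[OF dP dP] S])
      (simp add: bilinear_ladd[OF bil])
  moreover have "der (\<lambda>y. P y u (v + v')) x h = der (\<lambda>y. P y u v) x h + der (\<lambda>y. P y u v') x h" for u v v'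
    by (intro der_eqI has_derivative_transform_within_open[OF has_derivative_add[OF dP dP] S])
      (simp add: bilinear_radd[OF bil])
  moreover have "der (\<lambda>y. P y (c *\<^sub>R u) v) x h = c *\<^sub>R der (\<lambda>y. P y u v) x h" for c u v
    by (intro der_eqI has_derivative_transform_within_open[OF has_derivative_scaleR_right[OF dP] S])
      (simp add: bilinear_lmul[OF bil])
  moreover have "der (\<lambda>y. P y u (c *\<^sub>R v)) x h = c *\<^sub>R der (\<lambda>y. P y u v) x h" for c u v
    by (intro der_eqI has_derivative_transform_within_open[OF has_derivative_scaleR_right[OF dP] S])
      (simp add: bilinear_rmul[OF bil])
  ultimately show ?thesis
    unfolding bilinear_def by (auto intro!: linearI)
qed

section \<open>The Levi-Civita connection in a chart\<close>

locale riemannian_chart =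
  fixes S :: "'e::euclidean_space set" and G :: "'e \<Rightarrow> 'e \<Rightarrow> 'e \<Rightarrow> real"
  assumes open_S: "open S"
    and inner_product_G: "x \<in> S \<Longrightarrow> inner_product (G x)"
    and smooth_G: "smooth_on S (\<lambda>x. G x u v)"
begin

abbreviation "\<Gamma> \<equiv> christoffel G"

lemma bilinear_G: "x \<in> S \<Longrightarrow> bilinear (G x)"
  by (intro inner_product_bilinear inner_product_G)

lemma G_commute: "x \<in> S \<Longrightarrow> G x u v = G x v u"
  by (intro inner_product_commute inner_product_G)

lemma differentiable_G: "x \<in> S \<Longrightarrow> (\<lambda>y. G y u v) differentiable (at x)"
  using smooth_on_differentiable[OF smooth_G] .

lemma differentiable_der_G: "x \<in> S \<Longrightarrow> (\<lambda>y. der (\<lambda>y. G y u v) y h) differentiable (at x)"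
  using smooth_on_differentiable[OF smooth_on_der[OF smooth_G]] .

lemma bilinear_der_G: "x \<in> S \<Longrightarrow> bilinear (\<lambda>u v. der (\<lambda>y. G y u v) x h)"
  by (rule bilinear_der[OF open_S _ bilinear_G differentiable_G])

lemma der_G_commute:
  assumes "x \<in> S"
  shows "der (\<lambda>y. G y u v) x h = der (\<lambda>y. G y v u) x h"
  by (rule der_transform_within_open[OF differentiable_G[OF assms] open_S assms]) (rule G_commute)

lemma linear_der_G: "x \<in> S \<Longrightarrow> linear (der (\<lambda>y. G y u v) x)"
  by (intro linear_frechet_derivative differentiable_G)

text \<open>The Koszul expression is linear in \<open>z\<close>, hence represented by a unique
  vector.\<close>

lemma christoffel_spec:
  assumes x: "x \<in> S"
  shows "2 * G x (\<Gamma> x u v) z =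
    der (\<lambda>y. G y v z) x u + der (\<lambda>y. G y u z) x v - der (\<lambda>y. G y u v) x z"
proof -
  note bil = bilinear_der_G[OF x]
  have "linear (\<lambda>z. (der (\<lambda>y. G y v z) x u + der (\<lambda>y. G y u z) x v - der (\<lambda>y. G y u v) x z) / 2)"
    by (rule linearI)
      (simp_all add: bilinear_radd[OF bil] bilinear_rmul[OF bil] linear_add[OF linear_der_G[OF x]]
        linear_cmul[OF linear_der_G[OF x]] field_simps)
  from ex1_inner_product_representation[OF inner_product_G[OF x] this]
  have "\<exists>!w. \<forall>z. 2 * G x w z =
      der (\<lambda>y. G y v z) x u + der (\<lambda>y. G y u z) x v - der (\<lambda>y. G y u v) x z"
    by (simp add: field_simps)
  from theI'[OF this] show ?thesis
    unfolding christoffel_def by blast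
qed

lemma christoffel_eqI:
  assumes x: "x \<in> S" and "\<And>z. 2 * G x w z =
    der (\<lambda>y. G y v z) x u + der (\<lambda>y. G y u z) x v - der (\<lambda>y. G y u v) x z"
  shows "\<Gamma> x u v = w"
proof (rule inner_product_eqI[OF inner_product_G[OF x]])
  show "G x (\<Gamma> x u v) z = G x w z" for z
    using assms(2)[of z] christoffel_spec[OF x, of u v z] by simp
qed

lemma christoffel_commute:
  assumes x: "x \<in> S"
  shows "\<Gamma> x u v = \<Gamma> x v u"
  by (rule christoffel_eqI[OF x]) (simp add: christoffel_spec[OF x] der_G_commute[OF x, of u v])

text \<open>Adding the Koszul formulas for \<open>(h, u; v)\<close> and \<open>(h, v; u)\<close>
  cancels the derivatives in the directions \<open>u\<close> and \<open>v\<close>.\<close>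

lemma metric_compatible:
  assumes x: "x \<in> S"
  shows "der (\<lambda>y. G y u v) x h = G x (\<Gamma> x h u) v + G x u (\<Gamma> x h v)"
  using christoffel_spec[OF x, of h u v] christoffel_spec[OF x, of h v u]
    G_commute[OF x, of u "\<Gamma> x h v"] der_G_commute[OF x, of u v h]
  by simp

lemma bilinear_christoffel:
  assumes x: "x \<in> S"
  shows "bilinear (\<Gamma> x)"
proof -
  note simps = bilinear_ladd[OF bilinear_G[OF x]] bilinear_lmul[OF bilinear_G[OF x]]
    bilinear_ladd[OF bilinear_der_G[OF x]] bilinear_lmul[OF bilinear_der_G[OF x]]
    linear_add[OF linear_der_G[OF x]] linear_cmul[OF linear_der_G[OF x]]
  have 1: "linear (\<lambda>u. \<Gamma> x u v)" for v
  proof (rule linearI)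
    show "\<Gamma> x (u + u') v = \<Gamma> x u v + \<Gamma> x u' v" for u u'
      by (rule christoffel_eqI[OF x])
        (simp add: distrib_left christoffel_spec[OF x] simps)
    show "\<Gamma> x (c *\<^sub>R u) v = c *\<^sub>R \<Gamma> x u v" for c u
      by (rule christoffel_eqI[OF x])
        (simp add: mult.left_commute[of 2] christoffel_spec[OF x] simps algebra_simps)
  qed
  have "(\<lambda>u. \<Gamma> x u v) = \<Gamma> x v" for v
    by (rule ext) (rule christoffel_commute[OF x])
  with 1 have "linear (\<Gamma> x v)" for v
    by metis
  with 1 show ?thesis
    unfolding bilinear_def by blast
qed

text \<open>\<open>\<Gamma>\<close> is known only as the solution of the Koszul system, whose
  coefficients and right-hand side are smooth; its derivatives are needed for the curvature.\<close>

lemma differentiable_christoffel: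
  assumes x: "x \<in> S"
  shows "(\<lambda>y. \<Gamma> y u v) differentiable (at x)"
proof (rule differentiable_representative[OF open_S x inner_product_G differentiable_G[OF x]])
  show "G y (\<Gamma> y u v) z =
      1/2 * (der (\<lambda>y. G y v z) y u + der (\<lambda>y. G y u z) y v - der (\<lambda>y. G y u v) y z)"
    if "y \<in> S" for y z
    using christoffel_spec[OF that, of u v z] by simp
  show "(\<lambda>y. 1/2 * (der (\<lambda>y. G y v z) y u + der (\<lambda>y. G y u z) y v - der (\<lambda>y. G y u v) y z))
      differentiable (at x)" for z
    by (intro differentiable_mult differentiable_const differentiable_diff differentiable_add
        differentiable_der_G[OF x])
qed

lemma curvature_eq:
  "curvature G x u v w = der (\<lambda>y. \<Gamma> y v w) x u + \<Gamma> x u (\<Gamma> x v w)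
     - (der (\<lambda>y. \<Gamma> y u w) x v + \<Gamma> x v (\<Gamma> x u w))"
proof -
  have "cov_deriv G v (\<lambda>_. w) = (\<lambda>y. \<Gamma> y v w)" for v w
    by (simp add: fun_eq_iff cov_deriv_def)
  then show ?thesis
    by (simp add: curvature_def cov_deriv_def)
qed

lemma linear_der_christoffel: "x \<in> S \<Longrightarrow> linear (der (\<lambda>y. \<Gamma> y u v) x)"
  by (intro linear_frechet_derivative differentiable_christoffel)

text \<open>The slots are paired as (v, w) and (u, z) because sums of \<open>R(e, e', e', e)\<close>
  are traces over exactly these pairs.\<close>

lemma bilinear_curvature:
  assumes x: "x \<in> S"
  shows "bilinear (\<lambda>v w. G x (curvature G x u v w) z)"
    and "bilinear (\<lambda>u z. G x (curvature G x u v w) z)"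
proof -
  note bil = bilinear_der[OF open_S x bilinear_christoffel differentiable_christoffel[OF x]]
  note simps = bilinear_ladd[OF bilinear_G[OF x]] bilinear_lmul[OF bilinear_G[OF x]]
    bilinear_radd[OF bilinear_G[OF x]] bilinear_rmul[OF bilinear_G[OF x]]
    bilinear_lsub[OF bilinear_G[OF x]]
    bilinear_ladd[OF bil] bilinear_lmul[OF bil] bilinear_radd[OF bil] bilinear_rmul[OF bil]
    bilinear_ladd[OF bilinear_christoffel[OF x]] bilinear_lmul[OF bilinear_christoffel[OF x]]
    bilinear_radd[OF bilinear_christoffel[OF x]] bilinear_rmul[OF bilinear_christoffel[OF x]]
    linear_add[OF linear_der_christoffel[OF x]] linear_cmul[OF linear_der_christoffel[OF x]]
  show "bilinear (\<lambda>v w. G x (curvature G x u v w) z)"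
    unfolding bilinear_def by (auto intro!: linearI simp: curvature_eq simps algebra_simps)
  show "bilinear (\<lambda>u z. G x (curvature G x u v w) z)"
    unfolding bilinear_def by (auto intro!: linearI simp: curvature_eq simps algebra_simps)
qed

lemma has_derivative_christoffel_along:
  assumes Fx: "F x \<in> S" and F: "F differentiable (at x)"
    and a: "a differentiable (at x)" and b: "b differentiable (at x)"
  shows "((\<lambda>y. \<Gamma> (F y) (a y) (b y)) has_derivative (\<lambda>u. der (\<lambda>y. \<Gamma> y (a x) (b x)) (F x) (der F x u)
    + \<Gamma> (F x) (der a x u) (b x) + \<Gamma> (F x) (a x) (der b x u))) (at x)"
  by (rule has_derivative_bilinear_field[where P = \<Gamma> and F = F and W = S])
    (assumption | intro bilinear_christoffel has_derivative_der differentiable_christoffel open_S assms)+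

text \<open>Metric compatibility along a map: differentiating the metric itself contributes the two
  Christoffel terms that complete \<open>der a\<close> and \<open>der b\<close> to covariant
  derivatives.\<close>

lemma has_derivative_G_along:
  assumes Fx: "F x \<in> S" and F: "F differentiable (at x)"
    and a: "a differentiable (at x)" and b: "b differentiable (at x)"
  shows "((\<lambda>y. G (F y) (a y) (b y)) has_derivative (\<lambda>u.
    G (F x) (cov_deriv_along G F u a x) (b x) + G (F x) (a x) (cov_deriv_along G F u b x))) (at x)"
proof -
  have "((\<lambda>y. G (F y) (a y) (b y)) has_derivative (\<lambda>u. der (\<lambda>y. G y (a x) (b x)) (F x) (der F x u)
    + G (F x) (der a x u) (b x) + G (F x) (a x) (der b x u))) (at x)"
    by (rule has_derivative_bilinear_field[where P = G and F = F and W = S])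
      (assumption | intro bilinear_G has_derivative_der differentiable_G open_S assms)+
  then show ?thesis
    by (simp add: metric_compatible[OF Fx] cov_deriv_along_def bilinear_ladd[OF bilinear_G[OF Fx]]
        bilinear_radd[OF bilinear_G[OF Fx]] add_ac)
qed

lemma has_derivative_G:
  assumes x: "x \<in> S" and a: "a differentiable (at x)" and b: "b differentiable (at x)"
  shows "((\<lambda>y. G y (a y) (b y)) has_derivative (\<lambda>u.
    G x (cov_deriv G u a x) (b x) + G x (a x) (cov_deriv G u b x))) (at x)"
  using has_derivative_G_along[of "\<lambda>y. y" x a b] assms
  by (simp add: cov_deriv_along_def cov_deriv_def)

end

section \<open>The Gauss equation in charts\<close>

locale isometric_chart_map =
  M: riemannian_chart S G + N: riemannian_chart W Gb
  for S :: "'e::euclidean_space set" and G and W :: "'f::euclidean_space set" and Gb +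
  fixes U :: "'e set" and F :: "'e \<Rightarrow> 'f"
  assumes open_U: "open U" and U_subset: "U \<subseteq> S" and F_mem: "x \<in> U \<Longrightarrow> F x \<in> W"
    and smooth_F: "smooth_on U F"
    and isometry: "x \<in> U \<Longrightarrow> G x u v = Gb (F x) (der F x u) (der F x v)"
begin

definition hess :: "'e \<Rightarrow> 'e \<Rightarrow> 'e \<Rightarrow> 'f" where
  "hess x u v = cov_deriv_along Gb F u (\<lambda>y. der F y v) x"

text \<open>The Gauss formula read as a definition: the push-forward of the intrinsic connection is
  subtracted from the ambient one. Normality is proved in \<open>sff_normal\<close>, and
  \<open>normal_part_hess\<close> identifies it with the projection.\<close>

definition sff :: "'e \<Rightarrow> 'e \<Rightarrow> 'e \<Rightarrow> 'f" where
  "sff x u v = hess x u v - der F x (M.\<Gamma> x u v)"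

lemma differentiable_F:
  assumes "x \<in> U"
  shows "F differentiable (at x)" "(\<lambda>y. der F y v) differentiable (at x)"
    "(\<lambda>y. der (\<lambda>y. der F y v) y w) differentiable (at x)"
  by (rule smooth_on_differentiable[OF _ assms], intro smooth_on_der smooth_F)+

lemma linear_der_F: "x \<in> U \<Longrightarrow> linear (der F x)"
  by (intro linear_frechet_derivative differentiable_F)

lemma der_F_commute:
  assumes "x \<in> U"
  shows "der (\<lambda>y. der F y v) x u = der (\<lambda>y. der F y u) x v"
  by (rule der_der_commute[OF open_U assms differentiable_F(1) differentiable_F(2)[OF assms]])

lemma der_der_F_commute:
  assumes "x \<in> U"
  shows "der (\<lambda>y. der (\<lambda>y. der F y w) y v) x u = der (\<lambda>y. der (\<lambda>y. der F y w) y u) x v"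
  by (rule der_der_commute[OF open_U assms differentiable_F(2) differentiable_F(3)[OF assms]])

lemma hess_eq: "hess x u v = der (\<lambda>y. der F y v) x u + N.\<Gamma> (F x) (der F x u) (der F x v)"
  by (simp add: hess_def cov_deriv_along_def)

lemma hess_commute: "x \<in> U \<Longrightarrow> hess x u v = hess x v u"
  using der_F_commute[of x u v] N.christoffel_commute[OF F_mem] by (simp add: hess_eq)

lemma sff_commute: "x \<in> U \<Longrightarrow> sff x u v = sff x v u"
  using U_subset by (auto simp: sff_def hess_commute M.christoffel_commute)

lemma bilinear_sff:
  assumes x: "x \<in> U"
  shows "bilinear (sff x)"
proof -
  have xS: "x \<in> S" using x U_subset by auto
  note bil = N.bilinear_christoffel[OF F_mem[OF x]] M.bilinear_christoffel[OF xS]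
  note lin = linear_frechet_derivative[OF differentiable_F(2)[OF x]] linear_der_F[OF x]
  have 1: "linear (\<lambda>u. sff x u v)" for v
    by (rule linearI)
      (simp_all add: sff_def hess_eq linear_add[OF lin(1)] linear_cmul[OF lin(1)] linear_add[OF lin(2)]
        linear_cmul[OF lin(2)] bilinear_ladd[OF bil(1)] bilinear_lmul[OF bil(1)] bilinear_ladd[OF bil(2)]
        bilinear_lmul[OF bil(2)] algebra_simps)
  have "(\<lambda>u. sff x u v) = sff x v" for v
    by (rule ext) (rule sff_commute[OF x])
  with 1 have "linear (sff x v)" for v
    by metis
  with 1 show ?thesis
    unfolding bilinear_def by blast
qed

lemma der_G_hess:
  assumes x: "x \<in> U"
  shows "der (\<lambda>y. G y u v) x h =
    Gb (F x) (hess x h u) (der F x v) + Gb (F x) (der F x u) (hess x h v)"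
proof -
  have "((\<lambda>y. Gb (F y) (der F y u) (der F y v)) has_derivative (\<lambda>h. Gb (F x) (hess x h u) (der F x v)
      + Gb (F x) (der F x u) (hess x h v))) (at x)"
    unfolding hess_def
    by (intro N.has_derivative_G_along[where F = F and a = "\<lambda>y. der F y u" and b = "\<lambda>y. der F y v"]
        F_mem differentiable_F x)
  then have "((\<lambda>y. G y u v) has_derivative (\<lambda>h. Gb (F x) (hess x h u) (der F x v)
      + Gb (F x) (der F x u) (hess x h v))) (at x)"
    by (rule has_derivative_transform_within_open[OF _ open_U x]) (simp add: isometry)
  then show ?thesis by (rule der_eqI)
qed

text \<open>In the Koszul formula each derivative of \<open>G\<close> splits into two terms by
  \<open>der_G_hess\<close>. By symmetry of \<open>hess\<close>, four of the six cancel and the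
  other two agree.\<close>

lemma hess_tangential:
  assumes x: "x \<in> U"
  shows "Gb (F x) (hess x u v) (der F x z) = G x (M.\<Gamma> x u v) z"
proof -
  have xS: "x \<in> S" using x U_subset by auto
  show ?thesis
    using M.christoffel_spec[OF xS, of u v z]
      N.G_commute[OF F_mem[OF x], of "der F x u"] N.G_commute[OF F_mem[OF x], of "der F x v"]
    by (simp add: der_G_hess[OF x] hess_commute[OF x, of v u] hess_commute[OF x, of z])
qed

lemma sff_normal:
  assumes x: "x \<in> U"
  shows "Gb (F x) (sff x u v) (der F x z) = 0"
  using hess_tangential[OF x] isometry[OF x]
  by (simp add: sff_def bilinear_lsub[OF N.bilinear_G[OF F_mem[OF x]]])

lemma normal_part_hess:
  assumes x: "x \<in> U"
  shows "normal_part (Gb (F x)) (range (der F x)) (hess x u v) = sff x u v"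
proof (rule normal_part_eqI[OF N.inner_product_G[OF F_mem[OF x]]])
  show "subspace (range (der F x))"
    by (rule linear_subspace_image[OF linear_der_F[OF x]]) simp
  show "hess x u v - sff x u v \<in> range (der F x)"
    by (simp add: sff_def)
qed (auto simp: sff_normal[OF x])

lemma hess_inner:
  assumes x: "x \<in> U"
  shows "Gb (F x) (hess x u v) (hess x u' v') =
    Gb (F x) (sff x u v) (sff x u' v') + G x (M.\<Gamma> x u v) (M.\<Gamma> x u' v')"
proof -
  have "hess x u v = sff x u v + der F x (M.\<Gamma> x u v)" for u v
    by (simp add: sff_def)
  then show ?thesis
    using sff_normal[OF x, of u v] sff_normal[OF x, of u' v']
      N.G_commute[OF F_mem[OF x], of "der F x (M.\<Gamma> x u v)" "sff x u' v'"]
    by (simp add: bilinear_ladd[OF N.bilinear_G[OF F_mem[OF x]]]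
        bilinear_radd[OF N.bilinear_G[OF F_mem[OF x]]] isometry[OF x])
qed

lemma has_derivative_hess:
  assumes x: "x \<in> U"
  shows "((\<lambda>y. hess y v w) has_derivative (\<lambda>u. der (\<lambda>y. der (\<lambda>y. der F y w) y v) x u
    + (der (\<lambda>y. N.\<Gamma> y (der F x v) (der F x w)) (F x) (der F x u)
       + N.\<Gamma> (F x) (der (\<lambda>y. der F y v) x u) (der F x w)
       + N.\<Gamma> (F x) (der F x v) (der (\<lambda>y. der F y w) x u)))) (at x)"
  unfolding hess_eq
  by (intro has_derivative_add[OF has_derivative_der] differentiable_F x
      N.has_derivative_christoffel_along[where F = F and a = "\<lambda>y. der F y v" and b = "\<lambda>y. der F y w"] F_mem)

text \<open>In the difference the third derivatives of \<open>F\<close> cancel by symmetry, as do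
  all terms with a second derivative of \<open>F\<close>. What remains is the curvature expression
  of \<open>Gb\<close> on the pushed-forward vectors.\<close>

lemma cov_deriv_hess_commutator:
  assumes x: "x \<in> U"
  shows "cov_deriv_along Gb F u (\<lambda>y. hess y v w) x - cov_deriv_along Gb F v (\<lambda>y. hess y u w) x
    = curvature Gb (F x) (der F x u) (der F x v) (der F x w)"
  unfolding N.curvature_eq cov_deriv_along_def der_eqI[OF has_derivative_hess[OF x]]
  unfolding hess_eq
  using der_F_commute[OF x, of u v] der_der_F_commute[OF x, of w v u]
  by (simp add: bilinear_radd[OF N.bilinear_christoffel[OF F_mem[OF x]]])

lemma gauss_equation:
  assumes x: "x \<in> U"
  shows "G x (curvature G x u v w) z =
    Gb (F x) (curvature Gb (F x) (der F x u) (der F x v) (der F x w)) (der F x z)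
    + Gb (F x) (sff x v w) (sff x u z) - Gb (F x) (sff x u w) (sff x v z)"
proof -
  have xS: "x \<in> S" using x U_subset by auto
  \<comment> \<open>One scalar function, \<open>G y (\<Gamma> y v w) z\<close>, is differentiated
    twice over: in ambient terms through \<open>hess_tangential\<close> and intrinsically. By
    \<open>hess_inner\<close> the products of two Christoffel vectors agree on both sides and drop
    out.\<close>
  have *: "Gb (F x) (cov_deriv_along Gb F u (\<lambda>y. hess y v w) x) (der F x z)
      + Gb (F x) (sff x v w) (sff x u z)
    = G x (der (\<lambda>y. M.\<Gamma> y v w) x u + M.\<Gamma> x u (M.\<Gamma> x v w)) z" for u v
  proof -
    have "(\<lambda>y. hess y v w) differentiable (at x)"
      using has_derivative_hess[OF x] by (auto simp: differentiable_def)
    then have "((\<lambda>y. Gb (F y) (hess y v w) (der F y z)) has_derivative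
        (\<lambda>u. Gb (F x) (cov_deriv_along Gb F u (\<lambda>y. hess y v w) x) (der F x z)
          + Gb (F x) (hess x v w) (cov_deriv_along Gb F u (\<lambda>y. der F y z) x))) (at x)"
      by (intro N.has_derivative_G_along[where F = F and b = "\<lambda>y. der F y z"] F_mem differentiable_F x)
    then have "((\<lambda>y. G y (M.\<Gamma> y v w) z) has_derivative
        (\<lambda>u. Gb (F x) (cov_deriv_along Gb F u (\<lambda>y. hess y v w) x) (der F x z)
          + Gb (F x) (hess x v w) (cov_deriv_along Gb F u (\<lambda>y. der F y z) x))) (at x)"
      by (rule has_derivative_transform_within_open[OF _ open_U x]) (rule hess_tangential)
    moreover have "((\<lambda>y. G y (M.\<Gamma> y v w) z) has_derivative
        (\<lambda>u. G x (cov_deriv G u (\<lambda>y. M.\<Gamma> y v w) x) z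
          + G x (M.\<Gamma> x v w) (cov_deriv G u (\<lambda>y. z) x))) (at x)"
      by (intro M.has_derivative_G[OF xS] M.differentiable_christoffel[OF xS] differentiable_const)
    ultimately have "(\<lambda>u. Gb (F x) (cov_deriv_along Gb F u (\<lambda>y. hess y v w) x) (der F x z)
          + Gb (F x) (hess x v w) (cov_deriv_along Gb F u (\<lambda>y. der F y z) x))
        = (\<lambda>u. G x (cov_deriv G u (\<lambda>y. M.\<Gamma> y v w) x) z + G x (M.\<Gamma> x v w) (cov_deriv G u (\<lambda>y. z) x))"
      by (rule has_derivative_unique)
    from fun_cong[OF this, of u]
    have "Gb (F x) (cov_deriv_along Gb F u (\<lambda>y. hess y v w) x) (der F x z)
          + Gb (F x) (hess x v w) (hess x u z)
        = G x (cov_deriv G u (\<lambda>y. M.\<Gamma> y v w) x) z + G x (M.\<Gamma> x v w) (cov_deriv G u (\<lambda>y. z) x)"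
      unfolding hess_def[of x u z] .
    then show ?thesis
      by (simp add: hess_inner[OF x] cov_deriv_def)
  qed
  \<comment> \<open>Antisymmetrizing in \<open>u\<close> and \<open>v\<close> turns both sides into
    curvatures.\<close>
  show ?thesis
    unfolding M.curvature_eq cov_deriv_hess_commutator[OF x, symmetric]
    using *[of u v] *[of v u]
    by (simp add: bilinear_lsub[OF M.bilinear_G[OF xS]] bilinear_lsub[OF N.bilinear_G[OF F_mem[OF x]]])
qed

end

section \<open>Charts\<close>

lemma chart_at:
  assumes "smooth_manifold X A" "p \<in> topspace X"
  shows "chart_at A p \<in> A" "p \<in> fst (chart_at A p)"
proof -
  have "\<exists>c. c \<in> A \<and> p \<in> fst c"
    using assms unfolding smooth_manifold_def by blast
  then have "chart_at A p \<in> A \<and> p \<in> fst (chart_at A p)"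
    unfolding chart_at_def by (rule someI_ex)
  then show "chart_at A p \<in> A" "p \<in> fst (chart_at A p)" by auto
qed

lemma openin_chart: "smooth_manifold X A \<Longrightarrow> c \<in> A \<Longrightarrow> openin X (fst c)"
  unfolding smooth_manifold_def by blast

lemma chart_inv_left:
  assumes "smooth_manifold X A" "c \<in> A" "q \<in> fst c"
  shows "chart_inv c (snd c q) = q"
proof -
  have "fst c \<subseteq> topspace X"
    using openin_chart[OF assms(1,2)] by (rule openin_subset)
  moreover have "homeomorphic_map (subtopology X (fst c)) (top_of_set (snd c ` fst c)) (snd c)"
    using assms unfolding smooth_manifold_def by blast
  ultimately have "inj_on (snd c) (fst c)"
    using homeomorphic_imp_injective_map by (fastforce simp: inf_absorb2)
  then show ?thesis
    using assms(3) by (simp add: chart_inv_def)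
qed

lemma open_chart_image:
  assumes X: "smooth_manifold X A" "c \<in> A" and V: "openin X V" "V \<subseteq> fst c"
  shows "open (snd c ` V)"
proof -
  have "open (snd c ` fst c)"
    and "homeomorphic_map (subtopology X (fst c)) (top_of_set (snd c ` fst c)) (snd c)"
    using X unfolding smooth_manifold_def by blast+
  moreover have "openin (subtopology X (fst c)) V"
    using V by (auto simp: openin_subtopology)
  ultimately show ?thesis
    using homeomorphic_imp_open_map[of "subtopology X (fst c)" "top_of_set (snd c ` fst c)" "snd c"]
    unfolding open_map_def by (auto simp: openin_open_eq)
qed

text \<open>Transition maps are the local representatives of \<open>id\<close>, so changes of chart
  fall under the same chain rule as \<open>f\<close>.\<close>

lemma smooth_map_id: "smooth_manifold X A \<Longrightarrow> smooth_map X A X A id"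
  unfolding smooth_manifold_def smooth_map_def by (simp add: Int_def)

lemma loc_rep_at:
  assumes "smooth_manifold X A" "c \<in> A" "q \<in> fst c"
  shows "loc_rep c d f (snd c q) = snd d (f q)"
  by (simp add: loc_rep_def chart_inv_left[OF assms])

lemma openin_smooth_map_domain:
  assumes "smooth_manifold X A" "smooth_manifold Y B" "smooth_map X A Y B f" "c \<in> A" "d \<in> B"
  shows "openin X {q \<in> fst c. f q \<in> fst d}"
proof -
  have "continuous_map X Y f"
    using assms(3) unfolding smooth_map_def by (rule conjunct1)
  then have "openin X {q \<in> topspace X. f q \<in> fst d}"
    using openin_chart[OF assms(2,5)] by (rule openin_continuous_map_preimage)
  then have "openin X (fst c \<inter> {q \<in> topspace X. f q \<in> fst d})"
    by (rule openin_Int[OF openin_chart[OF assms(1,4)]])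
  moreover have "fst c \<inter> {q \<in> topspace X. f q \<in> fst d} = {q \<in> fst c. f q \<in> fst d}"
    using openin_subset[OF openin_chart[OF assms(1,4)]] by auto
  ultimately show ?thesis by simp
qed

lemma open_loc_rep_domain:
  assumes "smooth_manifold X A" "smooth_manifold Y B" "smooth_map X A Y B f" "c \<in> A" "d \<in> B"
  shows "open (snd c ` {q \<in> fst c. f q \<in> fst d})"
  by (rule open_chart_image[OF assms(1,4) openin_smooth_map_domain[OF assms]]) auto

lemma differentiable_loc_rep:
  assumes "smooth_map X A Y B f" "c \<in> A" "d \<in> B" "q \<in> fst c" "f q \<in> fst d"
  shows "loc_rep c d f differentiable (at (snd c q))"
proof -
  have "smooth_on (snd c ` {q \<in> fst c. f q \<in> fst d}) (loc_rep c d f)"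
    using assms unfolding smooth_map_def by blast
  then show ?thesis
    using assms by (intro smooth_on_differentiable) auto
qed

text \<open>With \<open>id\<close> for one of the maps, this is the change of chart before or after
  the other map.\<close>

lemma der_loc_rep_comp:
  assumes X: "smooth_manifold X A" and Y: "smooth_manifold Y B" and Z: "smooth_manifold Z C"
    and f: "smooth_map X A Y B f" and h: "smooth_map Y B Z C h"
    and c: "c \<in> A" "q \<in> fst c" and d: "d \<in> B" "f q \<in> fst d" and e: "e \<in> C" "h (f q) \<in> fst e"
  shows "der (loc_rep d e h) (snd d (f q)) (der (loc_rep c d f) (snd c q) u)
    = der (loc_rep c e (h \<circ> f)) (snd c q) u"
proof -
  define U where "U = snd c ` {q \<in> fst c. f q \<in> fst d}"
  have U: "open U" "snd c q \<in> U"
    using open_loc_rep_domain[OF X Y f c(1) d(1)] c d by (auto simp: U_def)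
  have 1: "(loc_rep c d f has_derivative der (loc_rep c d f) (snd c q)) (at (snd c q))"
    by (intro has_derivative_der differentiable_loc_rep[OF f] c d)
  have 2: "(loc_rep d e h has_derivative der (loc_rep d e h) (snd d (f q))) (at (loc_rep c d f (snd c q)))"
    unfolding loc_rep_at[OF X c]
    by (intro has_derivative_der differentiable_loc_rep[OF h] d e)
  have "((loc_rep c e (h \<circ> f)) has_derivative
      (der (loc_rep d e h) (snd d (f q)) \<circ> der (loc_rep c d f) (snd c q))) (at (snd c q))"
  proof (rule has_derivative_transform_within_open[OF diff_chain_at[OF 1 2] U])
    fix x assume "x \<in> U"
    then show "(loc_rep d e h \<circ> loc_rep c d f) x = loc_rep c e (h \<circ> f) x"
      using X Y c d by (auto simp: U_def loc_rep_def chart_inv_left)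
  qed
  from der_eqI[OF this, of u] show ?thesis by simp
qed

lemma der_loc_rep_refl:
  assumes X: "smooth_manifold X A" and c: "c \<in> A" "q \<in> fst c"
  shows "der (loc_rep c c id) (snd c q) u = u"
proof -
  have U: "open (snd c ` fst c)" "snd c q \<in> snd c ` fst c"
    using open_chart_image[OF X c(1) openin_chart[OF X c(1)]] c by auto
  have "(loc_rep c c id has_derivative (\<lambda>u. u)) (at (snd c q))"
    by (rule has_derivative_transform_within_open[OF has_derivative_ident U])
      (auto simp: loc_rep_def chart_inv_left[OF X c(1)])
  then show ?thesis by (rule der_eqI)
qed

lemma from_chart_chart_at:
  assumes "smooth_manifold X A" "p \<in> topspace X"
  shows "from_chart A (chart_at A p) p u = u"
  unfolding from_chart_def by (rule der_loc_rep_refl[OF assms(1) chart_at[OF assms]])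

lemma linear_inj_from_chart:
  assumes X: "smooth_manifold X A" and c: "c \<in> A" "q \<in> fst c"
  shows "linear (from_chart A c q)" "inj (from_chart A c q)"
proof -
  have q: "q \<in> topspace X"
    using openin_subset[OF openin_chart[OF X c(1)]] c by auto
  note c' = chart_at[OF X q]
  show "linear (from_chart A c q)"
    unfolding from_chart_def
    by (intro linear_frechet_derivative differentiable_loc_rep[OF smooth_map_id[OF X]]) (use c c' in auto)
  show "inj (from_chart A c q)"
  proof (rule inj_on_inverseI)
    fix u
    show "der (loc_rep (chart_at A q) c id) (snd (chart_at A q) q) (from_chart A c q u) = u"
      unfolding from_chart_def
      using der_loc_rep_comp[OF X X X smooth_map_id[OF X] smooth_map_id[OF X] c c'(1), of c u]
        c c' der_loc_rep_refl[OF X c]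
      by simp
  qed
qed

section \<open>Metrics and isometric immersions in charts\<close>

lemma inner_product_pullback:
  assumes b: "inner_product b" and T: "linear T" "inj T"
  shows "inner_product (\<lambda>u v. b (T u) (T v))"
  unfolding inner_product_def
proof (intro conjI allI impI)
  note bil = inner_product_bilinear[OF b]
  show "linear (\<lambda>u. b (T u) (T v))" for v
    by (rule linearI) (simp_all add: linear_add[OF T(1)] linear_cmul[OF T(1)] bilinear_ladd[OF bil] bilinear_lmul[OF bil])
  show "b (T u) (T v) = b (T v) (T u)" for u v
    by (rule inner_product_commute[OF b])
  show "b (T u) (T u) > 0" if "u \<noteq> 0" for u
    using b T that linear_injective_0[OF T(1)] unfolding inner_product_def by blast
qed

lemma riemannian_chart_metric_in_chart:
  assumes g: "riemannian_manifold X A g" and c: "c \<in> A"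
  shows "riemannian_chart (snd c ` fst c) (metric_in_chart A g c)"
proof
  have X: "smooth_manifold X A"
    using g by (simp add: riemannian_manifold_def)
  show "open (snd c ` fst c)"
    by (rule open_chart_image[OF X c openin_chart[OF X c] subset_refl])
  show "smooth_on (snd c ` fst c) (\<lambda>x. metric_in_chart A g c x u v)" for u v
    using g c unfolding riemannian_manifold_def by blast
  fix x assume "x \<in> snd c ` fst c"
  then obtain q where q: "q \<in> fst c" "x = snd c q" by auto
  have "q \<in> topspace X"
    using openin_subset[OF openin_chart[OF X c]] q by auto
  then have "inner_product (g q)"
    using g unfolding riemannian_manifold_def by blast
  from inner_product_pullback[OF this linear_inj_from_chart[OF X c q(1)]]
  show "inner_product (metric_in_chart A g c x)"
    unfolding metric_in_chart_def by (simp add: q chart_inv_left[OF X c])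
qed

text \<open>Holds at \<open>p\<close> itself; at nearby points a different chart may have been
  selected, and components have to be converted.\<close>

lemma metric_in_chart_chart_at:
  assumes "smooth_manifold X A" "p \<in> topspace X"
  shows "metric_in_chart A g (chart_at A p) (snd (chart_at A p) p) = g p"
  by (intro ext) (simp add: metric_in_chart_def chart_inv_left[OF assms(1) chart_at[OF assms]]
      from_chart_chart_at[OF assms])

lemma isometric_chart_map_loc_rep:
  assumes X: "riemannian_manifold X A g" and Y: "riemannian_manifold Y B gb"
    and f: "isometric_immersion X A g Y B gb f" and c: "c \<in> A" and d: "d \<in> B"
  shows "isometric_chart_map (snd c ` fst c) (metric_in_chart A g c) (snd d ` fst d)
    (metric_in_chart B gb d) (snd c ` {q \<in> fst c. f q \<in> fst d}) (loc_rep c d f)"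
proof -
  have sX: "smooth_manifold X A" and sY: "smooth_manifold Y B" and sf: "smooth_map X A Y B f"
    using X Y f by (auto simp: riemannian_manifold_def isometric_immersion_def)
  interpret M: riemannian_chart "snd c ` fst c" "metric_in_chart A g c"
    by (rule riemannian_chart_metric_in_chart[OF X c])
  interpret N: riemannian_chart "snd d ` fst d" "metric_in_chart B gb d"
    by (rule riemannian_chart_metric_in_chart[OF Y d])
  show ?thesis
  proof
    show "open (snd c ` {q \<in> fst c. f q \<in> fst d})"
      by (rule open_loc_rep_domain[OF sX sY sf c d])
    show "snd c ` {q \<in> fst c. f q \<in> fst d} \<subseteq> snd c ` fst c" by auto
    show "smooth_on (snd c ` {q \<in> fst c. f q \<in> fst d}) (loc_rep c d f)"
      using sf c d unfolding smooth_map_def by blast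
    fix x assume "x \<in> snd c ` {q \<in> fst c. f q \<in> fst d}"
    then obtain q where q: "q \<in> fst c" "f q \<in> fst d" and x: "x = snd c q" by auto
    show "loc_rep c d f x \<in> snd d ` fst d"
      using q by (simp add: x loc_rep_at[OF sX c])
    have qX: "q \<in> topspace X" and fqY: "f q \<in> topspace Y"
      using openin_subset[OF openin_chart[OF sX c]] openin_subset[OF openin_chart[OF sY d]] q by auto
    define c' where "c' = chart_at A q"
    define d' where "d' = chart_at B (f q)"
    have c': "c' \<in> A" "q \<in> fst c'" and d': "d' \<in> B" "f q \<in> fst d'"
      unfolding c'_def d'_def using chart_at[OF sX qX] chart_at[OF sY fqY] by auto
    \<comment> \<open>A commuting square: both sides equal the derivative of \<open>f\<close> from
      chart \<open>c\<close> to the chart selected at \<open>f q\<close>, computed once through the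
      chart selected at \<open>q\<close> and once through \<open>d\<close>. The identity is read as
      \<open>f \<circ> id\<close> and as \<open>id \<circ> f\<close> accordingly.\<close>
    have comp: "differential A B f q (from_chart A c q u) =
        from_chart B d (f q) (der (loc_rep c d f) x u)" for u
    proof -
      have "differential A B f q (from_chart A c q u) = der (loc_rep c d' (f \<circ> id)) x u"
        unfolding differential_def from_chart_def x c'_def[symmetric] d'_def[symmetric]
        using der_loc_rep_comp[OF sX sX sY smooth_map_id[OF sX] sf c q(1), of c' d' u] c' d' by simp
      also have "\<dots> = der (loc_rep c d' (id \<circ> f)) x u"
        by simp
      also have "\<dots> = from_chart B d (f q) (der (loc_rep c d f) x u)"
        unfolding from_chart_def x d'_def[symmetric]
        using der_loc_rep_comp[OF sX sY sY sf smooth_map_id[OF sY] c q(1) d q(2), of d' u] d' by simp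
      finally show ?thesis .
    qed
    have "metric_in_chart A g c x u v = g q (from_chart A c q u) (from_chart A c q v)" for u v
      by (simp add: metric_in_chart_def x chart_inv_left[OF sX c q(1)])
    also have "\<dots> u v = gb (f q) (differential A B f q (from_chart A c q u)) (differential A B f q (from_chart A c q v))"
      for u v
      using f qX unfolding isometric_immersion_def by blast
    finally show "metric_in_chart A g c x u v = metric_in_chart B gb d (loc_rep c d f x)
        (der (loc_rep c d f) x u) (der (loc_rep c d f) x v)" for u v
      by (simp add: comp metric_in_chart_def x loc_rep_at[OF sX c q(1)] chart_inv_left[OF sY d q(2)])
  qed
qed

section \<open>Mixed scalar curvature of an isometric immersion\<close>

text \<open>The curvature tensor of type (0,4). Unlike the quotient in
  \<open>sectional_curvature\<close> it is multilinear, so its traces can change bases.\<close>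

definition curvature_form ::
  "('a, 'e::euclidean_space) chart set \<Rightarrow> ('a \<Rightarrow> 'e \<Rightarrow> 'e \<Rightarrow> real) \<Rightarrow> 'a \<Rightarrow> 'e \<Rightarrow> 'e \<Rightarrow> 'e \<Rightarrow> 'e \<Rightarrow> real" where
  "curvature_form A g p u v w z =
     g p (curvature (metric_in_chart A g (chart_at A p)) (snd (chart_at A p) p) u v w) z"

lemma bilinear_curvature_form:
  assumes g: "riemannian_manifold X A g" and p: "p \<in> topspace X"
  shows "bilinear (\<lambda>v w. curvature_form A g p u v w z)" "bilinear (\<lambda>u z. curvature_form A g p u v w z)"
proof -
  have X: "smooth_manifold X A" using g by (simp add: riemannian_manifold_def)
  define c where "c = chart_at A p"
  have c: "c \<in> A" "p \<in> fst c" unfolding c_def by (rule chart_at[OF X p])+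
  interpret riemannian_chart "snd c ` fst c" "metric_in_chart A g c"
    by (rule riemannian_chart_metric_in_chart[OF g c(1)])
  have x: "snd c p \<in> snd c ` fst c" using c by auto
  have gp: "metric_in_chart A g c (snd c p) = g p"
    unfolding c_def by (rule metric_in_chart_chart_at[OF X p])
  show "bilinear (\<lambda>v w. curvature_form A g p u v w z)" "bilinear (\<lambda>u z. curvature_form A g p u v w z)"
    using bilinear_curvature[OF x] unfolding curvature_form_def c_def[symmetric] gp by auto
qed

lemma sectional_curvature_orthonormal:
  assumes "g p u u = 1" "g p v v = 1" "g p u v = 0"
  shows "sectional_curvature A g p u v = curvature_form A g p u v v u"
  using assms by (simp add: sectional_curvature_def curvature_form_def)

text \<open>On orthonormal pairs the denominator of the sectional curvature is 1, and the resulting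
  double trace can be moved to the bases \<open>E\<close>, one factor at a time. Later
  \<open>E\<close> is the image of a basis under the differential.\<close>

lemma mixed_scalar_curvature_eq:
  assumes g: "riemannian_manifold X A g" and p: "p \<in> topspace X"
    and V: "orthogonal_family (g p) k V"
    and E: "\<And>i. i \<in> {1..k} \<Longrightarrow> orthonormal_basis_of (g p) (V i) (E i)"
  shows "mixed_scalar_curvature A g k p V =
    (\<Sum>i=1..k. \<Sum>j=Suc i..k. \<Sum>e\<in>E i. \<Sum>e'\<in>E j. curvature_form A g p e e' e' e)"
  unfolding mixed_scalar_curvature_def
proof (rule sum.cong[OF refl], rule sum.cong[OF refl])
  fix i j assume "i \<in> {1..k}" "j \<in> {Suc i..k}"
  then have ij: "i \<in> {1..k}" "j \<in> {1..k}" "i \<noteq> j" by auto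
  have ip: "inner_product (g p)"
    using g p unfolding riemannian_manifold_def by blast
  let ?R = "curvature_form A g p"
  have onb: "orthonormal_basis_of (g p) (V l) (some_onb (g p) (V l))" if "l \<in> {1..k}" for l
  proof -
    have "span (E l) = V l" using E[OF that] unfolding orthonormal_basis_of_def by blast
    then show ?thesis by (metis ip some_onb subspace_span)
  qed
  note bil1 = bilinear_curvature_form(1)[OF g p] and bil2 = bilinear_curvature_form(2)[OF g p]
  have "(\<Sum>e\<in>some_onb (g p) (V i). \<Sum>e'\<in>some_onb (g p) (V j). sectional_curvature A g p e e')
    = (\<Sum>e\<in>some_onb (g p) (V i). \<Sum>e'\<in>some_onb (g p) (V j). ?R e e' e' e)"
  proof (intro sum.cong refl sectional_curvature_orthonormal)
    fix e e' assume e: "e \<in> some_onb (g p) (V i)" "e' \<in> some_onb (g p) (V j)"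
    show "g p e e = 1" "g p e' e' = 1"
      using e onb ij unfolding orthonormal_basis_of_def by auto
    show "g p e e' = 0"
      using V e ij onb[OF ij(1)] onb[OF ij(2)]
      unfolding orthogonal_family_def orthonormal_basis_of_def by blast
  qed
  also have "\<dots> = (\<Sum>e\<in>some_onb (g p) (V i). \<Sum>e'\<in>E j. ?R e e' e' e)"
    by (intro sum.cong refl orthonormal_basis_trace_unique[OF ip bil1 onb E] ij)
  also have "\<dots> = (\<Sum>e'\<in>E j. \<Sum>e\<in>some_onb (g p) (V i). ?R e e' e' e)"
    by (rule sum.swap)
  also have "\<dots> = (\<Sum>e'\<in>E j. \<Sum>e\<in>E i. ?R e e' e' e)"
    by (intro sum.cong refl orthonormal_basis_trace_unique[OF ip bil2 onb E] ij)
  also have "\<dots> = (\<Sum>e\<in>E i. \<Sum>e'\<in>E j. ?R e e' e' e)"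
    by (rule sum.swap)
  finally show "(\<Sum>e\<in>some_onb (g p) (V i). \<Sum>e'\<in>some_onb (g p) (V j). sectional_curvature A g p e e')
    = (\<Sum>e\<in>E i. \<Sum>e'\<in>E j. ?R e e' e' e)" .
qed

text \<open>The conclusions share the charts selected at \<open>p\<close> and \<open>f p\<close>. In
  these charts tangent vectors are their own components, so the chart results transfer without
  conversion.\<close>

lemma
  assumes X: "riemannian_manifold X A g" and Y: "riemannian_manifold Y B gb"
    and f: "isometric_immersion X A g Y B gb f" and p: "p \<in> topspace X"
  shows isometric_immersion_mem: "f p \<in> topspace Y"
    and linear_differential: "linear (differential A B f p)"
    and bilinear_second_fundamental_form: "bilinear (second_fundamental_form A B gb f p)"
    and second_fundamental_form_commute:
      "second_fundamental_form A B gb f p u v = second_fundamental_form A B gb f p v u"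
    and curvature_form_gauss:
      "curvature_form A g p u v w z =
        curvature_form B gb (f p) (differential A B f p u) (differential A B f p v)
          (differential A B f p w) (differential A B f p z)
        + gb (f p) (second_fundamental_form A B gb f p v w) (second_fundamental_form A B gb f p u z)
        - gb (f p) (second_fundamental_form A B gb f p u w) (second_fundamental_form A B gb f p v z)"
proof -
  have sX: "smooth_manifold X A" and sY: "smooth_manifold Y B" and sf: "smooth_map X A Y B f"
    using X Y f by (auto simp: riemannian_manifold_def isometric_immersion_def)
  show fp: "f p \<in> topspace Y"
    using sf p unfolding smooth_map_def continuous_map_def by auto
  define c where "c = chart_at A p"
  define d where "d = chart_at B (f p)"
  have c: "c \<in> A" "p \<in> fst c" and d: "d \<in> B" "f p \<in> fst d"
    unfolding c_def d_def using chart_at[OF sX p] chart_at[OF sY fp] by auto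
  interpret isometric_chart_map "snd c ` fst c" "metric_in_chart A g c" "snd d ` fst d"
    "metric_in_chart B gb d" "snd c ` {q \<in> fst c. f q \<in> fst d}" "loc_rep c d f"
    by (rule isometric_chart_map_loc_rep[OF X Y f c(1) d(1)])
  have x: "snd c p \<in> snd c ` {q \<in> fst c. f q \<in> fst d}" using c d by auto
  have df: "der (loc_rep c d f) (snd c p) = differential A B f p"
    by (simp add: differential_def c_def d_def)
  have Fx: "loc_rep c d f (snd c p) = snd d (f p)"
    by (rule loc_rep_at[OF sX c])
  have gp: "metric_in_chart A g c (snd c p) = g p" "metric_in_chart B gb d (snd d (f p)) = gb (f p)"
    unfolding c_def d_def using metric_in_chart_chart_at[OF sX p] metric_in_chart_chart_at[OF sY fp] by auto
  have h: "second_fundamental_form A B gb f p = sff (snd c p)"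
  proof (intro ext)
    show "second_fundamental_form A B gb f p u v = sff (snd c p) u v" for u v
      using normal_part_hess[OF x, of u v] unfolding df Fx gp
      by (simp add: second_fundamental_form_def Let_def hess_def flip: c_def d_def)
  qed
  show "linear (differential A B f p)"
    using linear_der_F[OF x] by (simp add: df)
  show "bilinear (second_fundamental_form A B gb f p)"
    unfolding h by (rule bilinear_sff[OF x])
  show "second_fundamental_form A B gb f p u v = second_fundamental_form A B gb f p v u"
    unfolding h by (rule sff_commute[OF x])
  show "curvature_form A g p u v w z =
        curvature_form B gb (f p) (differential A B f p u) (differential A B f p v)
          (differential A B f p w) (differential A B f p z)
        + gb (f p) (second_fundamental_form A B gb f p v w) (second_fundamental_form A B gb f p u z)
        - gb (f p) (second_fundamental_form A B gb f p u w) (second_fundamental_form A B gb f p v z)"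
    using gauss_equation[OF x, of u v w z]
    unfolding curvature_form_def h c_def[symmetric] d_def[symmetric] df Fx gp .
qed

lemma orthonormal_basis_image:
  assumes T: "linear T" "inj T" and iso: "\<And>u v. b u v = b' (T u) (T v)"
    and E: "orthonormal_basis_of b V E"
  shows "orthonormal_basis_of b' (T ` V) (T ` E)"
  using E iso T unfolding orthonormal_basis_of_def
  by (auto simp: linear_span_image[OF T(1)] inj_eq)

section \<open>The pointwise identity and its two defects\<close>

locale immersed_almost_product =
  fixes X :: "'a topology" and A :: "('a, 'e::euclidean_space) chart set"
    and g :: "'a \<Rightarrow> 'e \<Rightarrow> 'e \<Rightarrow> real"
    and Y :: "'b topology" and B :: "('b, 'f::euclidean_space) chart set"
    and gb :: "'b \<Rightarrow> 'f \<Rightarrow> 'f \<Rightarrow> real"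
    and f :: "'a \<Rightarrow> 'b" and D :: "nat \<Rightarrow> 'a \<Rightarrow> 'e set" and n :: "nat \<Rightarrow> nat" and k :: nat
  assumes product: "almost_product_manifold X A g k D n"
    and ambient: "riemannian_manifold Y B gb"
    and immersion: "isometric_immersion X A g Y B gb f"
begin

abbreviation "df \<equiv> differential A B f"
abbreviation "h \<equiv> second_fundamental_form A B gb f"
abbreviation "H\<^sub>D i p \<equiv> mean_curvature_on A g B gb f p (D i p)"
abbreviation "E i p \<equiv> some_onb (g p) (D i p)"

definition mean_curvature_defect :: "'a \<Rightarrow> real" where
  "mean_curvature_defect p = (\<Sum>i=1..k. \<Sum>j=Suc i..k. gb (f p) (H\<^sub>D i p - H\<^sub>D j p) (H\<^sub>D i p - H\<^sub>D j p))"

definition mixed_defect :: "'a \<Rightarrow> real" where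
  "mixed_defect p = (\<Sum>i=1..k. \<Sum>j=Suc i..k. \<Sum>e\<in>E i p. \<Sum>e'\<in>E j p. gb (f p) (h p e e') (h p e e'))"

lemma riemannian: "riemannian_manifold X A g"
  using product unfolding almost_product_manifold_def by blast

lemma k_ge_2: "k \<ge> 2"
  using product unfolding almost_product_manifold_def by blast

context
  fixes p assumes p: "p \<in> topspace X"
begin

lemma inner_product_domain: "inner_product (g p)"
  using riemannian p unfolding riemannian_manifold_def by blast

lemma f_mem: "f p \<in> topspace Y"
  by (rule isometric_immersion_mem[OF riemannian ambient immersion p])

lemma inner_product_ambient: "inner_product (gb (f p))"
  using ambient f_mem unfolding riemannian_manifold_def by blast

lemma subspace_D: "i \<in> {1..k} \<Longrightarrow> subspace (D i p)" "i \<in> {1..k} \<Longrightarrow> dim (D i p) = n i"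
  using product p unfolding almost_product_manifold_def distribution_def by blast+

lemma orthogonal_D: "orthogonal_family (g p) k (\<lambda>i. D i p)"
  using product p unfolding almost_product_manifold_def by blast

lemma onb_D: "i \<in> {1..k} \<Longrightarrow> orthonormal_basis_of (g p) (D i p) (E i p)"
  by (intro some_onb inner_product_domain subspace_D)

lemma inj_df: "inj (df p)" and isometry_df: "g p u v = gb (f p) (df p u) (df p v)"
  using immersion p unfolding isometric_immersion_def by blast+

lemma linear_df: "linear (df p)"
  by (rule linear_differential[OF riemannian ambient immersion p])

lemma orthogonal_df_D: "orthogonal_family (gb (f p)) k (\<lambda>i. df p ` D i p)"
  using orthogonal_D unfolding orthogonal_family_def by (auto simp: isometry_df)

lemma bilinear_h: "bilinear (h p)"
  by (rule bilinear_second_fundamental_form[OF riemannian ambient immersion p])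

lemma mean_curvature_eq_sum: "mean_curvature A g B gb f p = (\<Sum>i=1..k. H\<^sub>D i p)"
proof -
  note ip = inner_product_domain
  have orth: "g p e e' = 0" if "i \<in> {1..k}" "j \<in> {1..k}" "i \<noteq> j" "e \<in> E i p" "e' \<in> E j p" for i j e e'
    using orthogonal_D onb_D[OF that(1)] onb_D[OF that(2)] that
    unfolding orthogonal_family_def orthonormal_basis_of_def by blast
  have unit: "g p e e' = (if e = e' then 1 else 0)" if "i \<in> {1..k}" "e \<in> E i p" "e' \<in> E i p" for i e e'
    using onb_D[OF that(1)] that unfolding orthonormal_basis_of_def by blast
  \<comment> \<open>A common vector would be orthogonal to itself and of unit length. Disjointness
    is what lets the sum over the union split.\<close>
  have disj: "E i p \<inter> E j p = {}" if "i \<in> {1..k}" "j \<in> {1..k}" "i \<noteq> j" for i j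
    using orth[OF that] unit[OF that(1)] by (metis disjoint_iff zero_neq_one)
  have "orthonormal_basis_of (g p) UNIV (\<Union>i\<in>{1..k}. E i p)"
    unfolding orthonormal_basis_of_def
  proof (intro conjI ballI)
    have "v \<in> span (\<Union>i\<in>{1..k}. E i p)" for v
    proof -
      obtain w where w: "w \<in> (\<Pi>\<^sub>E i\<in>{1..k}. D i p)" "v = (\<Sum>i=1..k. w i)"
        using product p unfolding almost_product_manifold_def by blast
      have "w i \<in> span (\<Union>i\<in>{1..k}. E i p)" if "i \<in> {1..k}" for i
      proof -
        have "w i \<in> span (E i p)"
          using w(1) onb_D[OF that] that by (auto simp: orthonormal_basis_of_def)
        moreover have "span (E i p) \<subseteq> span (\<Union>i\<in>{1..k}. E i p)"
          by (rule span_mono) (use that in blast)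
        ultimately show ?thesis by blast
      qed
      then show ?thesis unfolding w(2) by (rule span_sum)
    qed
    then show "span (\<Union>i\<in>{1..k}. E i p) = UNIV" by blast
    fix e e' assume "e \<in> (\<Union>i\<in>{1..k}. E i p)" "e' \<in> (\<Union>i\<in>{1..k}. E i p)"
    then obtain i j where ij: "i \<in> {1..k}" "j \<in> {1..k}" "e \<in> E i p" "e' \<in> E j p" by blast
    show "g p e e' = (if e = e' then 1 else 0)"
    proof (cases "i = j")
      case True
      then show ?thesis using unit ij by blast
    next
      case False
      then have "e \<noteq> e'" using disj[OF ij(1,2)] ij by blast
      then show ?thesis using orth[OF ij(1,2) False ij(3,4)] by simp
    qed
  qed simp
  then have "mean_curvature A g B gb f p = (\<Sum>e\<in>(\<Union>i\<in>{1..k}. E i p). h p e e)"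
    unfolding mean_curvature_def mean_curvature_on_def
    by (intro orthonormal_basis_trace_unique[OF ip bilinear_h some_onb[OF ip]]) simp_all
  also have "\<dots> = (\<Sum>i=1..k. \<Sum>e\<in>E i p. h p e e)"
    using disj orthonormal_basis_finite[OF ip onb_D] by (intro sum.UNION_disjoint) blast+
  finally show ?thesis by (simp add: mean_curvature_on_def)
qed

lemma mixed_scalar_curvature_identity:
  "mixed_scalar_curvature A g k p (\<lambda>i. D i p) =
     mixed_scalar_curvature B gb k (f p) (\<lambda>i. df p ` D i p)
     + (real k - 1) / (2 * real k)
       * gb (f p) (mean_curvature A g B gb f p) (mean_curvature A g B gb f p)
     - mean_curvature_defect p / (2 * real k) - mixed_defect p"
proof -
  note bil = inner_product_bilinear[OF inner_product_ambient]
  let ?R = "curvature_form A g p" and ?Rb = "curvature_form B gb (f p)"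
  have inj: "inj_on (df p) V" for V
    using inj_df by (rule inj_on_subset) simp
  have "mixed_scalar_curvature A g k p (\<lambda>i. D i p) =
      (\<Sum>i=1..k. \<Sum>j=Suc i..k. \<Sum>e\<in>E i p. \<Sum>e'\<in>E j p. ?R e e' e' e)"
    by (rule mixed_scalar_curvature_eq[OF riemannian p orthogonal_D onb_D])
  also have "\<dots> = (\<Sum>i=1..k. \<Sum>j=Suc i..k. \<Sum>e\<in>E i p. \<Sum>e'\<in>E j p.
      ?Rb (df p e) (df p e') (df p e') (df p e) + gb (f p) (h p e e) (h p e' e') - gb (f p) (h p e e') (h p e e'))"
    \<comment> \<open>The Gauss equation with arguments \<open>e, e', e', e\<close>; symmetry of
      \<open>h\<close> turns the last term into a squared length.\<close>
    by (intro sum.cong refl, subst curvature_form_gauss[OF riemannian ambient immersion p])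
      (simp add: second_fundamental_form_commute[OF riemannian ambient immersion p, of _ _]
        inner_product_commute[OF inner_product_ambient])
  also have "\<dots> = (\<Sum>i=1..k. \<Sum>j=Suc i..k. \<Sum>e\<in>E i p. \<Sum>e'\<in>E j p. ?Rb (df p e) (df p e') (df p e') (df p e))
      + (\<Sum>i=1..k. \<Sum>j=Suc i..k. \<Sum>e\<in>E i p. \<Sum>e'\<in>E j p. gb (f p) (h p e e) (h p e' e'))
      - mixed_defect p"
    by (simp add: sum.distrib sum_subtractf mixed_defect_def)
  also have "(\<Sum>i=1..k. \<Sum>j=Suc i..k. \<Sum>e\<in>E i p. \<Sum>e'\<in>E j p. gb (f p) (h p e e) (h p e' e'))
      = (\<Sum>i=1..k. \<Sum>j=Suc i..k. gb (f p) (H\<^sub>D i p) (H\<^sub>D j p))"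
    by (simp only: mean_curvature_on_def bilinear_sum_left[OF bil] bilinear_sum_right[OF bil])
      (intro sum.cong refl sum.swap)
  also have "\<dots> = (real k - 1) / (2 * real k)
      * gb (f p) (mean_curvature A g B gb f p) (mean_curvature A g B gb f p)
      - mean_curvature_defect p / (2 * real k)"
    unfolding mean_curvature_eq_sum mean_curvature_defect_def
    by (rule sum_inner_product_pairs[OF inner_product_ambient]) (use k_ge_2 in simp)
  \<comment> \<open>The differential carries the selected bases to orthonormal bases of the image
    spaces, and its injectivity permits the reindexing.\<close>
  also have "(\<Sum>i=1..k. \<Sum>j=Suc i..k. \<Sum>e\<in>E i p. \<Sum>e'\<in>E j p. ?Rb (df p e) (df p e') (df p e') (df p e))
      = (\<Sum>i=1..k. \<Sum>j=Suc i..k. \<Sum>e\<in>df p ` E i p. \<Sum>e'\<in>df p ` E j p. ?Rb e e' e' e)"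
    by (simp add: sum.reindex[OF inj])
  also have "\<dots> = mixed_scalar_curvature B gb k (f p) (\<lambda>i. df p ` D i p)"
    by (rule mixed_scalar_curvature_eq[OF ambient f_mem orthogonal_df_D, symmetric])
      (rule orthonormal_basis_image[OF linear_df inj_df isometry_df onb_D])
  finally show ?thesis by simp
qed

lemma mixed_scalar_curvature_le_delta_mix:
  "ereal (mixed_scalar_curvature B gb k (f p) (\<lambda>i. df p ` D i p)) \<le> delta_mix Y B gb k n"
proof -
  have "subspace (df p ` D i p) \<and> dim (df p ` D i p) = n i" if "i \<in> {1..k}" for i
    using subspace_D[OF that] linear_subspace_image[OF linear_df] inj_df
    by (simp add: dim_image_eq[OF linear_df] inj_on_subset)
  then show ?thesis
    unfolding delta_mix_def using f_mem orthogonal_df_D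
    by (intro Sup_upper CollectI exI[of _ "f p"] exI[of _ "\<lambda>i. df p ` D i p"]) blast
qed

lemma mean_curvature_defect_ge_0: "mean_curvature_defect p \<ge> 0"
  unfolding mean_curvature_defect_def by (intro sum_nonneg inner_product_ge_0 inner_product_ambient)

lemma mixed_defect_ge_0: "mixed_defect p \<ge> 0"
  unfolding mixed_defect_def by (intro sum_nonneg inner_product_ge_0 inner_product_ambient)

lemma mean_curvature_defect_eq_0_iff:
  "mean_curvature_defect p = 0 \<longleftrightarrow> (\<forall>i\<in>{1..k}. \<forall>j\<in>{1..k}. H\<^sub>D i p = H\<^sub>D j p)"
proof -
  note nonneg = inner_product_ge_0[OF inner_product_ambient]
  have "mean_curvature_defect p = 0 \<longleftrightarrow> (\<forall>i\<in>{1..k}. \<forall>j\<in>{Suc i..k}. H\<^sub>D i p = H\<^sub>D j p)"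
    unfolding mean_curvature_defect_def
    by (simp add: sum_nonneg_eq_0_iff sum_nonneg nonneg inner_product_eq_0_iff[OF inner_product_ambient])
  also have "\<dots> \<longleftrightarrow> (\<forall>i\<in>{1..k}. \<forall>j\<in>{1..k}. H\<^sub>D i p = H\<^sub>D j p)"
  proof (intro iffI ballI)
    fix i j assume *: "\<forall>i\<in>{1..k}. \<forall>j\<in>{Suc i..k}. H\<^sub>D i p = H\<^sub>D j p" "i \<in> {1..k}" "j \<in> {1..k}"
    then show "H\<^sub>D i p = H\<^sub>D j p"
      by (cases i j rule: linorder_cases) (auto simp: Suc_le_eq)
  qed auto
  finally show ?thesis .
qed

text \<open>A sum of squared lengths vanishes only termwise. Bilinearity then extends from the bases
  to the distributions, and symmetry of \<open>h\<close> from \<open>i < j\<close> to all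
  \<open>i \<noteq> j\<close>.\<close>

lemma mixed_defect_eq_0_iff:
  "mixed_defect p = 0 \<longleftrightarrow>
    (\<forall>i\<in>{1..k}. \<forall>j\<in>{1..k}. i \<noteq> j \<longrightarrow> (\<forall>u\<in>D i p. \<forall>v\<in>D j p. h p u v = 0))"
proof -
  note nonneg = inner_product_ge_0[OF inner_product_ambient]
  note ip = inner_product_domain
  have fin: "finite (E i p)" if "i \<in> {1..k}" for i
    by (rule orthonormal_basis_finite[OF ip onb_D[OF that]])
  have sub: "E i p \<subseteq> D i p" if "i \<in> {1..k}" for i
    using onb_D[OF that] unfolding orthonormal_basis_of_def by blast
  have "mixed_defect p = 0 \<longleftrightarrow>
      (\<forall>i\<in>{1..k}. \<forall>j\<in>{Suc i..k}. \<forall>e\<in>E i p. \<forall>e'\<in>E j p. h p e e' = 0)"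
    unfolding mixed_defect_def
    by (simp add: sum_nonneg_eq_0_iff sum_nonneg nonneg fin inner_product_eq_0_iff[OF inner_product_ambient])
  also have "\<dots> \<longleftrightarrow> (\<forall>i\<in>{1..k}. \<forall>j\<in>{1..k}. i \<noteq> j \<longrightarrow> (\<forall>u\<in>D i p. \<forall>v\<in>D j p. h p u v = 0))"
    (is "?L \<longleftrightarrow> ?R")
  proof
    assume ?L
    have *: "h p u v = 0" if "i \<in> {1..k}" "j \<in> {1..k}" "i < j" "u \<in> D i p" "v \<in> D j p" for i j u v
    proof -
      have "h p u v = h p (\<Sum>e\<in>E i p. g p u e *\<^sub>R e) (\<Sum>e\<in>E j p. g p v e *\<^sub>R e)"
        by (intro arg_cong2[of _ _ _ _ "h p"] orthonormal_basis_expansion[OF ip onb_D] that)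
      also have "\<dots> = (\<Sum>e'\<in>E j p. \<Sum>e\<in>E i p. g p v e' *\<^sub>R g p u e *\<^sub>R h p e e')"
        by (simp only: bilinear_sum_left[OF bilinear_h] bilinear_sum_right[OF bilinear_h]
            bilinear_lmul[OF bilinear_h] bilinear_rmul[OF bilinear_h] scaleR_sum_right)
      also have "\<dots> = 0"
      proof (intro sum.neutral ballI)
        fix e e' assume "e \<in> E i p" "e' \<in> E j p"
        moreover have "j \<in> {Suc i..k}" using that by auto
        ultimately have "h p e e' = 0"
          using \<open>?L\<close> that(1) by blast
        then show "g p v e' *\<^sub>R g p u e *\<^sub>R h p e e' = 0"
          by simp
      qed
      finally show ?thesis .
    qed
    show ?R
    proof (intro ballI impI)
      fix i j u v assume a: "i \<in> {1..k}" "j \<in> {1..k}" "i \<noteq> j" "u \<in> D i p" "v \<in> D j p"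
      have "h p u v = h p v u"
        by (rule second_fundamental_form_commute[OF riemannian ambient immersion p])
      then show "h p u v = 0"
        using *[OF a(1,2) _ a(4,5)] *[OF a(2,1) _ a(5,4)] a(3) by (cases i j rule: linorder_cases) auto
    qed
  next
    assume R: ?R
    show ?L
    proof (intro ballI)
      fix i j e e' assume "i \<in> {1..k}" "j \<in> {Suc i..k}" "e \<in> E i p" "e' \<in> E j p"
      then show "h p e e' = 0"
        using R[rule_format, of i j e e'] sub[of i] sub[of j] by auto
    qed
  qed
  finally show ?thesis .
qed

end

end

theorem theorem1:
  fixes X :: "'a topology" and A :: "('a, 'e::euclidean_space) chart set"
    and g :: "'a \<Rightarrow> 'e \<Rightarrow> 'e \<Rightarrow> real"
    and Y :: "'b topology" and B :: "('b, 'f::euclidean_space) chart set"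
    and gb :: "'b \<Rightarrow> 'f \<Rightarrow> 'f \<Rightarrow> real"
    and f :: "'a \<Rightarrow> 'b" and D :: "nat \<Rightarrow> 'a \<Rightarrow> 'e set" and n :: "nat \<Rightarrow> nat" and k :: nat
  assumes "k \<ge> 2"
    and "almost_product_manifold X A g k D n"
    and "(\<Sum>i=1..k. n i) = DIM('e)"
    and "riemannian_manifold Y B gb"
    and "DIM('e) < DIM('f)"
    and "isometric_immersion X A g Y B gb f"
  defines "S \<equiv> \<lambda>p. mixed_scalar_curvature A g k p (\<lambda>i. D i p)"
    and "Sb \<equiv> \<lambda>p. mixed_scalar_curvature B gb k (f p) (\<lambda>i. differential A B f p ` D i p)"
    and "H \<equiv> \<lambda>p. mean_curvature A g B gb f p"
    and "Hi \<equiv> \<lambda>i p. mean_curvature_on A g B gb f p (D i p)"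
  defines "bound \<equiv> \<lambda>p. ereal ((real k - 1) / (2 * real k) * gb (f p) (H p) (H p))
                        + delta_mix Y B gb k n"
  shows "(\<forall>p\<in>topspace X. ereal (S p) \<le> bound p) \<and>
         ((\<forall>p\<in>topspace X. ereal (S p) = bound p) \<longleftrightarrow>
            mixed_totally_geodesic X A B gb f k D \<and>
            (\<forall>p\<in>topspace X. \<forall>i\<in>{1..k}. \<forall>j\<in>{1..k}. Hi i p = Hi j p) \<and>
            (\<forall>p\<in>topspace X. ereal (Sb p) = delta_mix Y B gb k n))"
proof -
  interpret immersed_almost_product X A g Y B gb f D n k
    by unfold_locales (fact assms)+
  define C where "C = (\<lambda>p. (real k - 1) / (2 * real k) * gb (f p) (H p) (H p))"
  define P where "P = (\<lambda>p. mean_curvature_defect p / (2 * real k))"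
  have pointwise: "ereal (S p) \<le> bound p"
    "ereal (S p) = bound p \<longleftrightarrow>
      mixed_defect p = 0 \<and> mean_curvature_defect p = 0 \<and> ereal (Sb p) = delta_mix Y B gb k n"
    if p: "p \<in> topspace X" for p
  proof -
    have S: "S p = Sb p + C p - P p - mixed_defect p"
      unfolding S_def Sb_def C_def P_def H_def by (rule mixed_scalar_curvature_identity[OF p])
    have nonneg: "P p \<ge> 0" "mixed_defect p \<ge> 0"
      using mean_curvature_defect_ge_0[OF p] mixed_defect_ge_0[OF p] by (simp_all add: P_def)
    have P0: "P p = 0 \<longleftrightarrow> mean_curvature_defect p = 0"
      using k_ge_2 by (simp add: P_def)
    have le: "ereal (Sb p) \<le> delta_mix Y B gb k n"
      unfolding Sb_def by (rule mixed_scalar_curvature_le_delta_mix[OF p])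
    have b: "bound p = ereal (C p) + delta_mix Y B gb k n"
      by (simp add: bound_def C_def)
    \<comment> \<open>Minus infinity is excluded by \<open>le\<close>. If the supremum is infinite,
      so is the bound: the inequality is trivial, and both sides of the equivalence fail because
      \<open>S p\<close> and \<open>Sb p\<close> are real. For a finite supremum, the gap is a sum
      of three nonnegative reals, which is 0 only if each is.\<close>
    show "ereal (S p) \<le> bound p"
      using le S nonneg by (cases "delta_mix Y B gb k n") (auto simp: b)
    show "ereal (S p) = bound p \<longleftrightarrow>
        mixed_defect p = 0 \<and> mean_curvature_defect p = 0 \<and> ereal (Sb p) = delta_mix Y B gb k n"
      using le S nonneg P0 by (cases "delta_mix Y B gb k n") (auto simp: b)
  qed
  have "mixed_totally_geodesic X A B gb f k D \<longleftrightarrow> (\<forall>p\<in>topspace X. mixed_defect p = 0)"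
    unfolding mixed_totally_geodesic_def using mixed_defect_eq_0_iff by blast
  moreover have "(\<forall>p\<in>topspace X. \<forall>i\<in>{1..k}. \<forall>j\<in>{1..k}. Hi i p = Hi j p) \<longleftrightarrow>
      (\<forall>p\<in>topspace X. mean_curvature_defect p = 0)"
    unfolding Hi_def using mean_curvature_defect_eq_0_iff by blast
  ultimately show ?thesis
    using pointwise by blast
qed

end
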